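(* Let $G$ be a graph with canonical decomposition $G=(G_k,A_k,B_k) \circ \dots \circ (G_1,A_1,B_1) \circ G_0$. Then $G$ is $\{2K_2,C_4,\text{kite}\}$-free if and only if $G_0$ is split or isomorphic to $C_5$, and every split indecomposable (canonical) component of $G$ having more than one vertex is a bottom-expanded spider.
   Context: All graphs are finite, with no loops or multiple edges. A graph is $\mathcal{F}$-free if it has no induced subgraph isomorphic to an element of $\mathcal{F}$. $2K_2$ is the disjoint union of two edges and $C_n$ the cycle on $n$ vertices. The chair is the tree with degree sequence $(3,2,1,1,1)$, and the kite is the complement of the chair (vertices $v,w,x,y,z$ and edges $vz,zy,zx,yx,yw,xw$). Canonical decomposition: A graph is split if its vertex set can be partitioned into an independent set and a clique (either may be empty). A splitted graph is a triple $(G,A,B)$ where $G$ is a split graph and $A,B$ is a partition of $V(G)$ into an independent set $A$ and a clique $B$. Isomorphism of splitted graphs $(G,A,B)\cong(G',A',B')$ means a graph isomorphism $V(G)\to V(G')$ carrying $A$ to $A'$. For a splitted graph $(G,A,B)$ and a graph $H$ on disjoint vertex sets, the composition $(G,A,B)\circ H$ is the graph formed by adding to the disjoint union $G+H$ all edges $uv$ with $u\in B$ and $v\in V(H)$. The composition of two splitted graphs is a splitted graph (take unions of the independent sets and of the cliques), and $\circ$ is associative. A graph is decomposable if it can be written as $(G,A,B)\circ H$ with $G$ and $H$ both having at least one vertex; otherwise it is indecomposable. By a theorem of Tyshkevich every graph $G$ has an expression $G=(G_k,A_k,B_k)\circ\dots\circ(G_1,A_1,B_1)\circ G_0$ with all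 $G_i$ indecomposable (and $k=0$ if $G$ is indecomposable), unique up to isomorphism of the splitted graphs $(G_i,A_i,B_i)$, $i\ge1$, and of $G_0$; this is the canonical decomposition, and $G_0,\dots,G_k$ are the canonical (indecomposable) components of $G$. Spiders: A headless (prime) spider is a graph whose vertex set admits a partition into an independent set $A$ (the feet) and a clique $B$ (the body vertices) with $|A|=|B|\ge 2$, such that there is a bijection $f:A\to B$ for which either (a) each $v\in A$ is adjacent only to $f(v)$, or (b) each $v\in A$ is adjacent to all vertices of $B$ except $f(v)$. To substitute a (nonempty) graph $H$ for a vertex $v$ of $J$ is to take the disjoint union of $H$ and $J-v$ and add all edges $uw$ with $u\in V(H)$ and $w\in N_J(v)$. A bottom-expanded spider is a graph obtained by substituting edgeless graphs (possibly single vertices) for feet in a headless spider. *)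

theory Defs
  imports "Graph_Theory.Graph_Theory"
begin

text \<open>
  A finite graph without loops or multiple edges is a value \<open>G :: 'a pair_pre_digraph\<close>
  satisfying \<open>pair_graph G\<close>: each edge \<open>uv\<close> is represented by the two arcs
  \<open>(u, v)\<close> and \<open>(v, u)\<close>, and \<open>parcs G `` {v}\<close> is the neighbourhood of \<open>v\<close>.
  The graph without vertices is allowed.
\<close>

type_synonym 'a graph = "'a pair_pre_digraph"

definition undirected :: "'a set \<Rightarrow> ('a \<times> 'a) set \<Rightarrow> 'a graph" where
  "undirected V E = mk_symmetric (with_proj \<lparr>pverts = V, parcs = E\<rparr>)"

definition complement_graph :: "'a graph \<Rightarrow> 'a graph" where
  "complement_graph G =
     \<lparr>pverts = pverts G,
      parcs = {(u, v). u \<in> pverts G \<and> v \<in> pverts G \<and> u \<noteq> v \<and> (u, v) \<notin> parcs G}\<rparr>"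

definition graph_iso :: "'a graph \<Rightarrow> 'b graph \<Rightarrow> bool" where
  "graph_iso G H \<longleftrightarrow> digraph_iso (with_proj G) (with_proj H)"

definition induced_free :: "'b graph set \<Rightarrow> 'a graph \<Rightarrow> bool" where
  "induced_free F G \<longleftrightarrow>
     \<not> (\<exists>H X. X \<in> F \<and> induced_subgraph (with_proj H) (with_proj G) \<and> graph_iso H X)"


definition two_K2 :: "nat graph" where
  "two_K2 = undirected {0, 1, 2, 3} {(0, 1), (2, 3)}"

text \<open>This is the cycle on \<open>n\<close> vertices only for \<open>n \<ge> 3\<close>.\<close>

definition cycle_graph :: "nat \<Rightarrow> nat graph" where
  "cycle_graph n = undirected {..<n} {(i, (i + 1) mod n) | i. i < n}"

definition chair :: "nat graph" where
  "chair = undirected {0, 1, 2, 3, 4} {(0, 1), (0, 2), (0, 3), (1, 4)}"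

definition kite :: "nat graph" where
  "kite = complement_graph chair"

text \<open>With \<open>v, w, x, y, z = 0, 1, 2, 3, 4\<close>, the edges are \<open>vz, zy, zx, yx, yw, xw\<close>.\<close>

lemma kite_eq:
  "kite = undirected {0, 1, 2, 3, 4} {(0, 4), (4, 3), (4, 2), (3, 2), (3, 1), (2, 1)}"
  by (auto simp: kite_def complement_graph_def chair_def undirected_def mk_symmetric_def)


definition independent_set :: "'a graph \<Rightarrow> 'a set \<Rightarrow> bool" where
  "independent_set G A \<longleftrightarrow> A \<subseteq> pverts G \<and> (\<forall>u\<in>A. \<forall>v\<in>A. (u, v) \<notin> parcs G)"

definition clique :: "'a graph \<Rightarrow> 'a set \<Rightarrow> bool" where
  "clique G B \<longleftrightarrow> B \<subseteq> pverts G \<and> (\<forall>u\<in>B. \<forall>v\<in>B. u \<noteq> v \<longrightarrow> (u, v) \<in> parcs G)"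

definition split_partition :: "'a graph \<Rightarrow> 'a set \<Rightarrow> 'a set \<Rightarrow> bool" where
  "split_partition G A B \<longleftrightarrow>
     A \<union> B = pverts G \<and> A \<inter> B = {} \<and> independent_set G A \<and> clique G B"

definition split_graph :: "'a graph \<Rightarrow> bool" where
  "split_graph G \<longleftrightarrow> pair_graph G \<and> (\<exists>A B. split_partition G A B)"

type_synonym 'a splitted = "'a graph \<times> 'a set \<times> 'a set"

fun splitted_graph :: "'a splitted \<Rightarrow> bool" where
  "splitted_graph (G, A, B) \<longleftrightarrow> pair_graph G \<and> split_partition G A B"

text \<open>The composition is meaningful only for operands with disjoint vertex sets; wherever it
  is used, disjointness is required separately.\<close>

fun compose :: "'a splitted \<Rightarrow> 'a graph \<Rightarrow> 'a graph" (infixr \<open>\<odot>\<close> 65) where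
  "(G, A, B) \<odot> H =
     \<lparr>pverts = pverts G \<union> pverts H,
      parcs = parcs G \<union> parcs H \<union> B \<times> pverts H \<union> pverts H \<times> B\<rparr>"

definition decomposable :: "'a graph \<Rightarrow> bool" where
  "decomposable G \<longleftrightarrow>
     (\<exists>G' A B H. splitted_graph (G', A, B) \<and> pair_graph H \<and>
        pverts G' \<inter> pverts H = {} \<and> pverts G' \<noteq> {} \<and> pverts H \<noteq> {} \<and>
        G = (G', A, B) \<odot> H)"

text \<open>A decomposition \<open>(G\<^sub>k, A\<^sub>k, B\<^sub>k) \<circ> \<dots> \<circ> (G\<^sub>1, A\<^sub>1, B\<^sub>1) \<circ> G\<^sub>0\<close> is given by the
  list \<open>Ss = [(G\<^sub>k, A\<^sub>k, B\<^sub>k), \<dots>, (G\<^sub>1, A\<^sub>1, B\<^sub>1)]\<close>, in this order, and by \<open>G\<^sub>0\<close>.\<close>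

definition components :: "'a splitted list \<Rightarrow> 'a graph \<Rightarrow> 'a graph list" where
  "components Ss G0 = map fst Ss @ [G0]"

text \<open>As disjointness is symmetric, the \<open>sorted_wrt\<close> condition says that components at
  distinct positions have disjoint vertex sets. The components must have vertices, as otherwise
  the decomposition would not be unique (vertexless components could be inserted at will); the
  exception \<open>Ss = []\<close> only serves to give the vertexless graph its trivial decomposition.\<close>

definition canonical_decomposition :: "'a graph \<Rightarrow> 'a splitted list \<Rightarrow> 'a graph \<Rightarrow> bool" where
  "canonical_decomposition G Ss G0 \<longleftrightarrow>
     (\<forall>S\<in>set Ss. splitted_graph S) \<and> pair_graph G0 \<and>
     sorted_wrt disjnt (map pverts (components Ss G0)) \<and>
     (Ss \<noteq> [] \<longrightarrow> (\<forall>H\<in>set (components Ss G0). pverts H \<noteq> {})) \<and>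
     (\<forall>H\<in>set (components Ss G0). \<not> decomposable H) \<and>
     G = foldr (\<odot>) Ss G0"


text \<open>\<open>A\<close> is the set of feet and \<open>B\<close> the set of body vertices.\<close>

definition headless_spider :: "'a graph \<Rightarrow> 'a set \<Rightarrow> 'a set \<Rightarrow> bool" where
  "headless_spider S A B \<longleftrightarrow>
     pair_graph S \<and> split_partition S A B \<and> card A = card B \<and> card A \<ge> 2 \<and>
     (\<exists>f. bij_betw f A B \<and>
        ((\<forall>v\<in>A. parcs S `` {v} = {f v}) \<or> (\<forall>v\<in>A. parcs S `` {v} = B - {f v})))"

text \<open>Substitution of \<open>H\<close> for the vertex \<open>v\<close> of \<open>J\<close>; meaningful only if \<open>H\<close> is disjoint
  from \<open>J - v\<close>.\<close>

definition substitute :: "'a graph \<Rightarrow> 'a \<Rightarrow> 'a graph \<Rightarrow> 'a graph" where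
  "substitute J v H =
     \<lparr>pverts = pverts H \<union> (pverts J - {v}),
      parcs = parcs H \<union> {(x, y) \<in> parcs J. x \<noteq> v \<and> y \<noteq> v}
        \<union> pverts H \<times> (parcs J `` {v}) \<union> (parcs J `` {v}) \<times> pverts H\<rparr>"

text \<open>\<open>foot_expansion J A\<close>: the graph \<open>J\<close> arises from a headless spider by substituting
  edgeless graphs for some feet, one foot after another, and \<open>A\<close> is the set of the feet of that
  spider for which nothing has been substituted yet.\<close>

inductive foot_expansion :: "'a graph \<Rightarrow> 'a set \<Rightarrow> bool" where
  spider: "headless_spider S A B \<Longrightarrow> foot_expansion S A"
| expand: "\<lbrakk>foot_expansion J A; v \<in> A; pair_graph H; parcs H = {}; pverts H \<noteq> {};
            pverts H \<inter> (pverts J - {v}) = {}\<rbrakk>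
           \<Longrightarrow> foot_expansion (substitute J v H) (A - {v})"

definition bottom_expanded_spider :: "'a graph \<Rightarrow> bool" where
  "bottom_expanded_spider G \<longleftrightarrow> (\<exists>A. foot_expansion G A)"

end

theory Submission
  imports Defs
begin

text \<open>
  The three forbidden graphs are indecomposable, so an induced copy of one of them in \<open>G\<close> lies
  inside a single component. It remains to determine the indecomposable graphs without induced
  \<open>2K\<^sub>2\<close>, \<open>C\<^sub>4\<close> and kite. If such a graph contains an induced \<open>C\<^sub>5\<close>, each further vertex is
  adjacent to all or to none of its vertices, the former being a clique and the latter
  independent, so by indecomposability there are no further vertices; otherwise the graph is
  split by the theorem of Foeldes and Hammer. In a split graph with independent set \<open>A\<close> and clique
  \<open>B\<close>, the absence of a kite means that, for all \<open>a, a' \<in> A\<close> with \<open>N(a')\<close> not contained in \<open>N(a)\<close>,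
  the set \<open>N(a) - N(a')\<close> has at most one element. A smaller neighbourhood is then contained in
  every larger one, and two neighbourhoods of different sizes would give a decomposition. Distinct
  neighbourhoods of the same size differ by exchanging one vertex, so they all contain a common
  set \<open>K\<close> with one vertex less or are all contained in a common set with one vertex more.
  Indecomposability makes the former empty and the latter equal to \<open>B\<close>.
\<close>

section \<open>Graphs as relations, induced subgraphs and embeddings\<close>

lemma pair_graph_iff:
  "pair_graph G \<longleftrightarrow>
     finite (pverts G) \<and> parcs G \<subseteq> pverts G \<times> pverts G \<and> sym (parcs G) \<and> irrefl (parcs G)"
proof
  assume "pair_graph G"
  then interpret pair_graph G .
  show "finite (pverts G) \<and> parcs G \<subseteq> pverts G \<times> pverts G \<and> sym (parcs G) \<and> irrefl (parcs G)"
    using pair_finite_verts in_arcsD1 in_arcsD2 arcs_symmetric no_loops'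
    by (fastforce intro!: symI irreflI)
next
  assume G: "finite (pverts G) \<and> parcs G \<subseteq> pverts G \<times> pverts G \<and> sym (parcs G) \<and> irrefl (parcs G)"
  then have "finite (parcs G)"
    by (meson finite_SigmaI finite_subset)
  with G show "pair_graph G"
    by unfold_locales (auto simp: irrefl_def symmetric_def)
qed

abbreviation (in pair_pre_digraph) adj :: "'a \<Rightarrow> 'a \<Rightarrow> bool" (infix \<open>\<sim>\<close> 50) where
  "u \<sim> v \<equiv> (u, v) \<in> parcs G"

lemma (in pair_graph) adj_sym: "u \<sim> v \<longleftrightarrow> v \<sim> u"
  using arcs_symmetric by blast

lemma (in pair_graph) nonadj_sym: "\<not> u \<sim> v \<Longrightarrow> \<not> v \<sim> u"
  using adj_sym by blast

lemma (in pair_graph) adj_irrefl [simp]: "\<not> u \<sim> u"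
  using no_loops' by blast

lemma pair_graph_undirected:
  assumes "finite V" "E \<subseteq> V \<times> V" "irrefl E"
  shows "pair_graph (undirected V E)"
  using assms
  by (auto simp: pair_graph_iff undirected_def mk_symmetric_def irrefl_def intro!: symI)

definition induced :: "'a graph \<Rightarrow> 'a set \<Rightarrow> 'a graph" where
  "induced G W = \<lparr>pverts = W, parcs = parcs G \<inter> W \<times> W\<rparr>"

lemma induced_simps [simp]:
  "pverts (induced G W) = W"
  "parcs (induced G W) = parcs G \<inter> W \<times> W"
  by (simp_all add: induced_def)

lemma pair_graph_induced:
  "pair_graph G \<Longrightarrow> W \<subseteq> pverts G \<Longrightarrow> pair_graph (induced G W)"
  by (auto simp: pair_graph_iff irrefl_def sym_def intro: finite_subset)

text \<open>Adjacency is preserved and reflected, so these are induced copies. Stating them by a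
  vertex map alone keeps the library's subgraph and isomorphism records out of the later arguments;
  \<open>embeds_iff\<close> makes the link.\<close>

definition embeds :: "'b graph \<Rightarrow> 'a graph \<Rightarrow> bool" where
  "embeds X G \<longleftrightarrow> (\<exists>f. inj_on f (pverts X) \<and> f ` pverts X \<subseteq> pverts G \<and>
     (\<forall>u\<in>pverts X. \<forall>v\<in>pverts X. (u, v) \<in> parcs X \<longleftrightarrow> (f u, f v) \<in> parcs G))"

lemma embeds_induced: "embeds X (induced G W) \<Longrightarrow> W \<subseteq> pverts G \<Longrightarrow> embeds X G"
  unfolding embeds_def by (erule exE, rule_tac x = f in exI) (auto simp: image_subset_iff)

text \<open>In a graph with \<open>with_proj\<close> an arc is the pair of its ends, so the arc map
  of an isomorphism is determined by its vertex map. The map \<open>f\<close> runs from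
  \<open>X\<close> to \<open>G\<close>, opposite to the isomorphism record, because embeddings run
  that way.\<close>

lemma graph_iso_iff:
  assumes "pair_graph G" "pair_graph X"
  shows "graph_iso G X \<longleftrightarrow> (\<exists>f. bij_betw f (pverts X) (pverts G) \<and>
    (\<forall>u\<in>pverts X. \<forall>v\<in>pverts X. (u, v) \<in> parcs X \<longleftrightarrow> (f u, f v) \<in> parcs G))"
proof
  interpret G: pair_graph G by fact
  assume "graph_iso G X"
  then obtain h where h: "pre_digraph.digraph_isomorphism (with_proj G) h"
    and X: "with_proj X = app_iso h (with_proj G)"
    by (auto simp: graph_iso_def digraph_iso_def)
  let ?g = "iso_verts h"
  have inj: "inj_on ?g (pverts G)"
    using h by (simp add: G.digraph_isomorphism_def)
  have V: "pverts X = ?g ` pverts G"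
    using arg_cong[OF X, of verts] by simp
  \<comment> \<open>Both end maps of \<open>with_proj X\<close> are projections; comparing the
    record fields therefore forces the image of an arc to be the pair of the images of its
    ends.\<close>
  have "iso_tail h = fst" "iso_head h = snd"
    using arg_cong[OF X, of tail] arg_cong[OF X, of head] by simp_all
  then have arc: "iso_arcs h (u, v) = (?g u, ?g v)" if "(u, v) \<in> parcs G" for u v
    using h that by (auto simp: G.digraph_isomorphism_def prod_eq_iff)
  have "parcs X = iso_arcs h ` parcs G"
    using arg_cong[OF X, of arcs] by simp
  also have "\<dots> = map_prod ?g ?g ` parcs G"
    using arc by (intro image_cong) auto
  finally have E: "parcs X = map_prod ?g ?g ` parcs G" .
  have iff: "(?g u, ?g v) \<in> parcs X \<longleftrightarrow> (u, v) \<in> parcs G" if "u \<in> pverts G" "v \<in> pverts G" for u v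
    using that inj G.in_arcsD1 G.in_arcsD2 by (auto simp: E inj_on_eq_iff)
  let ?f = "the_inv_into (pverts G) ?g"
  have "bij_betw ?f (pverts X) (pverts G)"
    using inj V bij_betw_the_inv_into[of ?g] by (auto simp: bij_betw_def)
  moreover have "(u, v) \<in> parcs X \<longleftrightarrow> (?f u, ?f v) \<in> parcs G"
    if "u \<in> pverts X" "v \<in> pverts X" for u v
    using that inj iff by (auto simp: V the_inv_into_f_f)
  ultimately show "\<exists>f. bij_betw f (pverts X) (pverts G) \<and>
    (\<forall>u\<in>pverts X. \<forall>v\<in>pverts X. (u, v) \<in> parcs X \<longleftrightarrow> (f u, f v) \<in> parcs G)"
    by blast
next
  interpret G: pair_graph G by fact
  interpret X: pair_graph X by fact
  assume "\<exists>f. bij_betw f (pverts X) (pverts G) \<and>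
    (\<forall>u\<in>pverts X. \<forall>v\<in>pverts X. (u, v) \<in> parcs X \<longleftrightarrow> (f u, f v) \<in> parcs G)"
  then obtain f where f: "bij_betw f (pverts X) (pverts G)"
    and iff: "\<And>u v. u \<in> pverts X \<Longrightarrow> v \<in> pverts X \<Longrightarrow> (u, v) \<in> parcs X \<longleftrightarrow> (f u, f v) \<in> parcs G"
    by blast
  define g where "g = the_inv_into (pverts X) f"
  have g: "bij_betw g (pverts G) (pverts X)" "\<And>v. v \<in> pverts G \<Longrightarrow> f (g v) = v"
    using f by (auto simp: g_def bij_betw_the_inv_into f_the_inv_into_f_bij_betw)
  have gV: "g v \<in> pverts X" if "v \<in> pverts G" for v
    using g(1) that by (auto simp: bij_betw_def)
  define h where "h = \<lparr>iso_verts = g, iso_arcs = map_prod g g, iso_head = snd, iso_tail = fst\<rparr>"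
  have "parcs X = map_prod g g ` parcs G"
  proof (rule subset_antisym)
    show "parcs X \<subseteq> map_prod g g ` parcs G"
    proof (rule subrelI)
      fix u v assume uv: "(u, v) \<in> parcs X"
      then have "u \<in> pverts X" "v \<in> pverts X"
        by (auto dest: X.in_arcsD1 X.in_arcsD2)
      then have "g (f u) = u" "g (f v) = v" "(f u, f v) \<in> parcs G"
        using f uv iff by (auto simp: g_def bij_betw_def the_inv_into_f_f)
      then show "(u, v) \<in> map_prod g g ` parcs G"
        by force
    qed
    have "(g u, g v) \<in> parcs X" if uv: "(u, v) \<in> parcs G" for u v
      using uv iff[of "g u" "g v"] g(2) gV G.in_arcsD1[OF uv] G.in_arcsD2[OF uv] by simp
    then show "map_prod g g ` parcs G \<subseteq> parcs X"
      by auto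
  qed
  then have "with_proj X = app_iso h (with_proj G)"
    using g(1) by (auto simp: h_def app_iso_def with_proj_def bij_betw_def)
  moreover have "inj_on (map_prod g g) (parcs G)"
  proof (rule inj_on_subset[OF map_prod_inj_on])
    show "inj_on g (pverts G)" "inj_on g (pverts G)"
      using g(1) by (simp_all add: bij_betw_def)
    show "parcs G \<subseteq> pverts G \<times> pverts G"
      using assms(1) by (simp add: pair_graph_iff)
  qed
  then have "G.digraph_isomorphism h"
    using g(1) G.wf_digraph by (auto simp: G.digraph_isomorphism_def h_def bij_betw_def)
  ultimately show "graph_iso G X"
    by (auto simp: graph_iso_def digraph_iso_def)
qed

lemma embeds_iff:
  assumes G: "pair_graph G" and X: "pair_graph X"
  shows "embeds X G \<longleftrightarrow> (\<exists>H. induced_subgraph (with_proj H) (with_proj G) \<and> graph_iso H X)"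
proof
  interpret G: pair_graph G by fact
  assume "embeds X G"
  then obtain f where f: "inj_on f (pverts X)" "f ` pverts X \<subseteq> pverts G"
    "\<And>u v. u \<in> pverts X \<Longrightarrow> v \<in> pverts X \<Longrightarrow> (u, v) \<in> parcs X \<longleftrightarrow> (f u, f v) \<in> parcs G"
    unfolding embeds_def by blast
  define H where "H = induced G (f ` pverts X)"
  have H: "pair_graph H"
    unfolding H_def using G f(2) by (rule pair_graph_induced)
  then interpret H: pair_graph H .
  have "graph_iso H X"
    using f by (subst graph_iso_iff[OF H X]) (auto simp: H_def bij_betw_def intro!: exI[of _ f])
  moreover have "induced_subgraph (with_proj H) (with_proj G)"
    using f(2) G.wf_digraph H.wf_digraph
    by (auto simp: induced_subgraph_def subgraph_def compatible_def H_def)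
  ultimately show "\<exists>H. induced_subgraph (with_proj H) (with_proj G) \<and> graph_iso H X"
    by blast
next
  interpret G: pair_graph G by fact
  assume "\<exists>H. induced_subgraph (with_proj H) (with_proj G) \<and> graph_iso H X"
  then obtain H where H: "induced_subgraph (with_proj H) (with_proj G)" and iso: "graph_iso H X"
    by blast
  have V: "pverts H \<subseteq> pverts G"
    and E: "parcs H = {e \<in> parcs G. fst e \<in> pverts H \<and> snd e \<in> pverts H}"
    using H by (auto simp: induced_subgraph_def subgraph_def)
  have HG: "H = induced G (pverts H)"
    by (rule pair_pre_digraph.equality) (auto simp: E)
  then have "pair_graph H"
    using pair_graph_induced[OF G V] by simp
  then have "embeds X H"
    using iso X by (auto simp: graph_iso_iff embeds_def bij_betw_def)
  then show "embeds X G"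
    using HG V embeds_induced by metis
qed

lemma induced_free_iff:
  assumes "pair_graph G" "\<And>X. X \<in> F \<Longrightarrow> pair_graph X"
  shows "induced_free F G \<longleftrightarrow> (\<forall>X\<in>F. \<not> embeds X G)"
  using assms by (auto simp: induced_free_def embeds_iff)

section \<open>The forbidden graphs and the 5-cycle as configurations of vertices\<close>

lemma pair_graph_two_K2: "pair_graph two_K2"
  unfolding two_K2_def by (rule pair_graph_undirected) (auto simp: irrefl_def)

lemma cycle_graph_4: "cycle_graph 4 = undirected {0, 1, 2, 3} {(0, 1), (1, 2), (2, 3), (3, 0)}"
proof -
  have V: "{..<4::nat} = {0, 1, 2, 3}"
    by auto
  have "{(i, (i + 1) mod 4) | i. i < (4::nat)} = (\<lambda>i. (i, (i + 1) mod 4)) ` {..<4}"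
    by auto
  also have "\<dots> = {(0, 1), (1, 2), (2, 3), (3, 0)}"
    unfolding V by (simp del: One_nat_def)
  finally show ?thesis
    by (simp only: cycle_graph_def V)
qed

lemma cycle_graph_5:
  "cycle_graph 5 = undirected {0, 1, 2, 3, 4} {(0, 1), (1, 2), (2, 3), (3, 4), (4, 0)}"
proof -
  have V: "{..<5::nat} = {0, 1, 2, 3, 4}"
    by auto
  have "{(i, (i + 1) mod 5) | i. i < (5::nat)} = (\<lambda>i. (i, (i + 1) mod 5)) ` {..<5}"
    by auto
  also have "\<dots> = {(0, 1), (1, 2), (2, 3), (3, 4), (4, 0)}"
    unfolding V by (simp del: One_nat_def)
  finally show ?thesis
    by (simp only: cycle_graph_def V)
qed

lemma pair_graph_cycle_4: "pair_graph (cycle_graph 4)"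
  unfolding cycle_graph_4 by (rule pair_graph_undirected) (auto simp: irrefl_def)

lemma pair_graph_cycle_5: "pair_graph (cycle_graph 5)"
  unfolding cycle_graph_5 by (rule pair_graph_undirected) (auto simp: irrefl_def)

lemma pair_graph_kite: "pair_graph kite"
  unfolding kite_eq by (rule pair_graph_undirected) (auto simp: irrefl_def)

context pair_graph
begin

text \<open>Distinctness of the four vertices is implied: identifying two of them would turn a
  listed edge into a listed non-edge. The same mechanism gives distinctness for the 5-cycle and the
  kite below.\<close>

lemma embeds_two_K2_iff:
  "embeds two_K2 G \<longleftrightarrow> (\<exists>a b c d. a \<sim> b \<and> c \<sim> d \<and> \<not> a \<sim> c \<and> \<not> a \<sim> d \<and> \<not> b \<sim> c \<and> \<not> b \<sim> d)"
proof
  assume "embeds two_K2 G"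
  then obtain f where "\<forall>u\<in>pverts two_K2. \<forall>v\<in>pverts two_K2. (u, v) \<in> parcs two_K2 \<longleftrightarrow> f u \<sim> f v"
    unfolding embeds_def by blast
  then show "\<exists>a b c d. a \<sim> b \<and> c \<sim> d \<and> \<not> a \<sim> c \<and> \<not> a \<sim> d \<and> \<not> b \<sim> c \<and> \<not> b \<sim> d"
    by (intro exI[of _ "f 0"] exI[of _ "f 1"] exI[of _ "f 2"] exI[of _ "f 3"])
      (simp add: two_K2_def undirected_def mk_symmetric_def)
next
  assume "\<exists>a b c d. a \<sim> b \<and> c \<sim> d \<and> \<not> a \<sim> c \<and> \<not> a \<sim> d \<and> \<not> b \<sim> c \<and> \<not> b \<sim> d"
  then obtain a b c d where
    *: "a \<sim> b" "c \<sim> d" "\<not> a \<sim> c" "\<not> a \<sim> d" "\<not> b \<sim> c" "\<not> b \<sim> d" by blast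
  moreover have "distinct [a, b, c, d]"
    using * adj_sym by auto
  moreover have "{a, b, c, d} \<subseteq> pverts G"
    using * in_arcsD1 in_arcsD2 by blast
  ultimately show "embeds two_K2 G"
    unfolding embeds_def
    by (intro exI[of _ "\<lambda>i. [a, b, c, d] ! i"])
      (auto simp: two_K2_def undirected_def mk_symmetric_def *
        *(1,2)[THEN arcs_symmetric] *(3-6)[THEN nonadj_sym])
qed

text \<open>Here the two inequalities are stated explicitly, since a single edge traversed back and
  forth satisfies all the other conditions.\<close>

lemma embeds_C4_iff:
  "embeds (cycle_graph 4) G \<longleftrightarrow> (\<exists>a b c d. a \<sim> b \<and> b \<sim> c \<and> c \<sim> d \<and> d \<sim> a \<and>
     \<not> a \<sim> c \<and> \<not> b \<sim> d \<and> a \<noteq> c \<and> b \<noteq> d)"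
proof
  assume "embeds (cycle_graph 4) G"
  then obtain f where "inj_on f (pverts (cycle_graph 4))"
    "\<forall>u\<in>pverts (cycle_graph 4). \<forall>v\<in>pverts (cycle_graph 4).
      (u, v) \<in> parcs (cycle_graph 4) \<longleftrightarrow> f u \<sim> f v"
    unfolding embeds_def by blast
  then show "\<exists>a b c d. a \<sim> b \<and> b \<sim> c \<and> c \<sim> d \<and> d \<sim> a \<and>
      \<not> a \<sim> c \<and> \<not> b \<sim> d \<and> a \<noteq> c \<and> b \<noteq> d"
    by (intro exI[of _ "f 0"] exI[of _ "f 1"] exI[of _ "f 2"] exI[of _ "f 3"])
      (simp add: cycle_graph_4 undirected_def mk_symmetric_def)
next
  assume "\<exists>a b c d. a \<sim> b \<and> b \<sim> c \<and> c \<sim> d \<and> d \<sim> a \<and>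
    \<not> a \<sim> c \<and> \<not> b \<sim> d \<and> a \<noteq> c \<and> b \<noteq> d"
  then obtain a b c d where
    *: "a \<sim> b" "b \<sim> c" "c \<sim> d" "d \<sim> a" "\<not> a \<sim> c" "\<not> b \<sim> d" "a \<noteq> c" "b \<noteq> d" by blast
  moreover have "distinct [a, b, c, d]"
    using * by auto
  moreover have "{a, b, c, d} \<subseteq> pverts G"
    using * in_arcsD1 in_arcsD2 by blast
  ultimately show "embeds (cycle_graph 4) G"
    unfolding embeds_def
    by (intro exI[of _ "\<lambda>i. [a, b, c, d] ! i"])
      (auto simp: cycle_graph_4 undirected_def mk_symmetric_def *
        *(1-4)[THEN arcs_symmetric] *(5,6)[THEN nonadj_sym])
qed

text \<open>The non-edges are oriented cyclically, like the edges, so that rotating the five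
  arguments merely permutes the conjuncts.\<close>

definition is_C5 :: "'a \<Rightarrow> 'a \<Rightarrow> 'a \<Rightarrow> 'a \<Rightarrow> 'a \<Rightarrow> bool" where
  "is_C5 a b c d e \<longleftrightarrow> a \<sim> b \<and> b \<sim> c \<and> c \<sim> d \<and> d \<sim> e \<and> e \<sim> a \<and>
     \<not> a \<sim> c \<and> \<not> b \<sim> d \<and> \<not> c \<sim> e \<and> \<not> d \<sim> a \<and> \<not> e \<sim> b"

lemma is_C5_rotate: "is_C5 a b c d e \<Longrightarrow> is_C5 b c d e a"
  by (simp add: is_C5_def)

lemma is_C5_distinct: "is_C5 a b c d e \<Longrightarrow> distinct [a, b, c, d, e]"
  using adj_sym by (auto simp: is_C5_def)

lemma is_C5_embedding:
  assumes "is_C5 a b c d e"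
  shows "\<exists>f. bij_betw f (pverts (cycle_graph 5)) {a, b, c, d, e} \<and>
    (\<forall>u\<in>pverts (cycle_graph 5). \<forall>v\<in>pverts (cycle_graph 5).
       (u, v) \<in> parcs (cycle_graph 5) \<longleftrightarrow> f u \<sim> f v)"
proof -
  have adj: "a \<sim> b" "b \<sim> c" "c \<sim> d" "d \<sim> e" "e \<sim> a"
    and nonadj: "\<not> a \<sim> c" "\<not> b \<sim> d" "\<not> c \<sim> e" "\<not> d \<sim> a" "\<not> e \<sim> b"
    using assms by (simp_all add: is_C5_def)
  show ?thesis
    using is_C5_distinct[OF assms]
    by (intro exI[of _ "\<lambda>i. [a, b, c, d, e] ! i"])
      (auto simp: cycle_graph_5 undirected_def mk_symmetric_def bij_betw_def adj nonadj adj[THEN arcs_symmetric] nonadj[THEN nonadj_sym])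
qed

lemma embeds_kite_iff:
  "embeds kite G \<longleftrightarrow> (\<exists>v w x y z. v \<sim> z \<and> z \<sim> y \<and> z \<sim> x \<and> y \<sim> x \<and> y \<sim> w \<and> x \<sim> w \<and>
     \<not> v \<sim> w \<and> \<not> v \<sim> x \<and> \<not> v \<sim> y \<and> \<not> z \<sim> w)"
proof
  assume "embeds kite G"
  then obtain f where "\<forall>u\<in>pverts kite. \<forall>v\<in>pverts kite. (u, v) \<in> parcs kite \<longleftrightarrow> f u \<sim> f v"
    unfolding embeds_def by blast
  then show "\<exists>v w x y z. v \<sim> z \<and> z \<sim> y \<and> z \<sim> x \<and> y \<sim> x \<and> y \<sim> w \<and> x \<sim> w \<and>
     \<not> v \<sim> w \<and> \<not> v \<sim> x \<and> \<not> v \<sim> y \<and> \<not> z \<sim> w"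
    by (intro exI[of _ "f 0"] exI[of _ "f 1"] exI[of _ "f 2"] exI[of _ "f 3"] exI[of _ "f 4"])
      (simp add: kite_eq undirected_def mk_symmetric_def)
next
  assume "\<exists>v w x y z. v \<sim> z \<and> z \<sim> y \<and> z \<sim> x \<and> y \<sim> x \<and> y \<sim> w \<and> x \<sim> w \<and>
     \<not> v \<sim> w \<and> \<not> v \<sim> x \<and> \<not> v \<sim> y \<and> \<not> z \<sim> w"
  then obtain v w x y z where
    *: "v \<sim> z" "z \<sim> y" "z \<sim> x" "y \<sim> x" "y \<sim> w" "x \<sim> w"
    "\<not> v \<sim> w" "\<not> v \<sim> x" "\<not> v \<sim> y" "\<not> z \<sim> w" by blast
  moreover have "distinct [v, w, x, y, z]"
    using * *(1-6)[THEN arcs_symmetric] *(7-10)[THEN nonadj_sym] by auto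
  moreover have "{v, w, x, y, z} \<subseteq> pverts G"
    using * in_arcsD1 in_arcsD2 by blast
  ultimately show "embeds kite G"
    unfolding embeds_def
    by (intro exI[of _ "\<lambda>i. [v, w, x, y, z] ! i"])
      (auto simp: kite_eq undirected_def mk_symmetric_def *
        *(1-6)[THEN arcs_symmetric] *(7-10)[THEN nonadj_sym])
qed

end

section \<open>Decomposability as a condition on vertex sets\<close>

text \<open>The operands of a composition are recovered as the subgraphs induced on
  \<open>A \<union> B\<close> and on the remaining vertices. Decomposability thus speaks about
  subsets of \<open>G\<close> only, which can be pulled back along embeddings.\<close>

lemma decomposable_iff:
  assumes "pair_graph G"
  shows "decomposable G \<longleftrightarrow> (\<exists>A B. independent_set G A \<and> clique G B \<and> A \<inter> B = {} \<and>
    A \<union> B \<noteq> {} \<and> A \<union> B \<noteq> pverts G \<and>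
    (\<forall>v\<in>pverts G - (A \<union> B). (\<forall>a\<in>A. (a, v) \<notin> parcs G) \<and> (\<forall>b\<in>B. (b, v) \<in> parcs G)))"
proof
  assume "decomposable G"
  then obtain S A B H where S: "splitted_graph (S, A, B)" and H: "pair_graph H"
    and disj: "pverts S \<inter> pverts H = {}" and ne: "pverts S \<noteq> {}" "pverts H \<noteq> {}"
    and G: "G = (S, A, B) \<odot> H"
    unfolding decomposable_def by blast
  have wf: "parcs S \<subseteq> pverts S \<times> pverts S" "parcs H \<subseteq> pverts H \<times> pverts H"
    and AB: "A \<union> B = pverts S" "A \<inter> B = {}" "independent_set S A" "clique S B"
    using S H by (auto simp: pair_graph_iff split_partition_def)
  have "independent_set G A"
    using wf AB disj unfolding G by (fastforce simp: independent_set_def)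
  moreover have "clique G B"
    using AB unfolding G by (auto simp: clique_def)
  moreover have "A \<union> B \<noteq> {}" "A \<union> B \<noteq> pverts G"
    using AB disj ne unfolding G by auto
  moreover have "(a, v) \<notin> parcs G" if "v \<in> pverts G - (A \<union> B)" "a \<in> A" for a v
    using that wf AB disj unfolding G by auto
  moreover have "(b, v) \<in> parcs G" if "v \<in> pverts G - (A \<union> B)" "b \<in> B" for b v
    using that AB unfolding G by auto
  ultimately show "\<exists>A B. independent_set G A \<and> clique G B \<and> A \<inter> B = {} \<and>
    A \<union> B \<noteq> {} \<and> A \<union> B \<noteq> pverts G \<and>
    (\<forall>v\<in>pverts G - (A \<union> B). (\<forall>a\<in>A. (a, v) \<notin> parcs G) \<and> (\<forall>b\<in>B. (b, v) \<in> parcs G))"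
    using AB by (intro exI[of _ A] exI[of _ B] conjI ballI) auto
next
  interpret pair_graph G by fact
  assume "\<exists>A B. independent_set G A \<and> clique G B \<and> A \<inter> B = {} \<and>
    A \<union> B \<noteq> {} \<and> A \<union> B \<noteq> pverts G \<and>
    (\<forall>v\<in>pverts G - (A \<union> B). (\<forall>a\<in>A. (a, v) \<notin> parcs G) \<and> (\<forall>b\<in>B. (b, v) \<in> parcs G))"
  then obtain A B where AB: "independent_set G A" "clique G B" "A \<inter> B = {}"
    "A \<union> B \<noteq> {}" "A \<union> B \<noteq> pverts G"
    and out: "\<And>a v. v \<in> pverts G - (A \<union> B) \<Longrightarrow> a \<in> A \<Longrightarrow> \<not> a \<sim> v"
      "\<And>b v. v \<in> pverts G - (A \<union> B) \<Longrightarrow> b \<in> B \<Longrightarrow> b \<sim> v" by blast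
  define S where "S = induced G (A \<union> B)"
  define H where "H = induced G (pverts G - (A \<union> B))"
  have sub: "A \<union> B \<subseteq> pverts G"
    using AB by (auto simp: independent_set_def clique_def)
  have "splitted_graph (S, A, B)"
    using AB sub pair_graph_induced[OF assms]
    by (auto simp: S_def split_partition_def independent_set_def clique_def)
  moreover have "pair_graph H"
    unfolding H_def by (rule pair_graph_induced[OF assms]) auto
  moreover have "G = (S, A, B) \<odot> H"
  proof (rule pair_pre_digraph.equality)
    have "u \<sim> v \<longleftrightarrow> (u, v) \<in> parcs ((S, A, B) \<odot> H)" for u v
    proof (cases "u \<in> pverts G \<and> v \<in> pverts G")
      case True
      then show ?thesis
        using AB(3) out out(1)[THEN nonadj_sym] out(2)[THEN arcs_symmetric]
        by (cases "u \<in> A \<union> B"; cases "v \<in> A \<union> B") (auto simp: S_def H_def)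
    next
      case False
      then show ?thesis
        using sub in_arcsD1 in_arcsD2 by (auto simp: S_def H_def)
    qed
    then show "parcs G = parcs ((S, A, B) \<odot> H)"
      by auto
  qed (use sub in \<open>auto simp: S_def H_def\<close>)
  moreover have "pverts S \<inter> pverts H = {}" "pverts S \<noteq> {}" "pverts H \<noteq> {}"
    using AB sub by (auto simp: S_def H_def)
  ultimately show "decomposable G"
    unfolding decomposable_def by blast
qed

text \<open>A form suited to concrete graphs: all quantifiers are bounded by the vertex set, so
  simplification expands them and leaves a propositional problem about membership in
  \<open>A\<close> and \<open>B\<close>.\<close>

lemma decomposableE:
  assumes "pair_graph G" "decomposable G"
  obtains A B where
    "\<forall>u\<in>pverts G. \<forall>v\<in>pverts G. (u, v) \<in> parcs G \<longrightarrow> u \<in> A \<longrightarrow> v \<in> B"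
    "\<forall>u\<in>pverts G. \<forall>v\<in>pverts G. u \<noteq> v \<and> (u, v) \<notin> parcs G \<longrightarrow> u \<in> B \<longrightarrow> v \<in> A"
    "\<forall>u\<in>pverts G. \<not> (u \<in> A \<and> u \<in> B)"
    "\<exists>u\<in>pverts G. u \<in> A \<or> u \<in> B" "\<exists>v\<in>pverts G. v \<notin> A \<and> v \<notin> B"
proof -
  obtain A B where AB: "independent_set G A" "clique G B" "A \<inter> B = {}"
    "A \<union> B \<noteq> {}" "A \<union> B \<noteq> pverts G"
    and out: "\<And>a v. v \<in> pverts G - (A \<union> B) \<Longrightarrow> a \<in> A \<Longrightarrow> (a, v) \<notin> parcs G"
      "\<And>b v. v \<in> pverts G - (A \<union> B) \<Longrightarrow> b \<in> B \<Longrightarrow> (b, v) \<in> parcs G"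
    using assms unfolding decomposable_iff[OF assms(1)] by blast
  show thesis
  proof (rule that[of A B])
    show "\<forall>u\<in>pverts G. \<forall>v\<in>pverts G. (u, v) \<in> parcs G \<longrightarrow> u \<in> A \<longrightarrow> v \<in> B"
      using AB(1) out(1) unfolding independent_set_def by blast
    show "\<forall>u\<in>pverts G. \<forall>v\<in>pverts G. u \<noteq> v \<and> (u, v) \<notin> parcs G \<longrightarrow> u \<in> B \<longrightarrow> v \<in> A"
      using AB(2) out(2) unfolding clique_def by blast
  qed (use AB in \<open>auto simp: independent_set_def clique_def\<close>)
qed

text \<open>Neighbours of vertices in \<open>A\<close> are forced into \<open>B\<close>, and
  non-neighbours of vertices in \<open>B\<close> into \<open>A\<close>. In each of the three
  forbidden graphs, starting from any vertex, this propagates until a vertex lies in both sets or no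
  vertex is left outside.\<close>

lemma two_K2_indecomposable: "\<not> decomposable two_K2"
  by (rule notI, erule decomposableE[OF pair_graph_two_K2],
      simp (no_asm_use) add: two_K2_def undirected_def mk_symmetric_def, argo)

lemma C4_indecomposable: "\<not> decomposable (cycle_graph 4)"
  by (rule notI, erule decomposableE[OF pair_graph_cycle_4],
      simp (no_asm_use) add: cycle_graph_4 undirected_def mk_symmetric_def, argo)

lemma kite_indecomposable: "\<not> decomposable kite"
  by (rule notI, erule decomposableE[OF pair_graph_kite],
      simp (no_asm_use) add: kite_eq undirected_def mk_symmetric_def, argo)

section \<open>The 5-cycle contains none of the forbidden graphs\<close>

lemma parcs_cycle_5:
  "parcs (cycle_graph 5) =
    {(0, 1), (1, 0), (1, 2), (2, 1), (2, 3), (3, 2), (3, 4), (4, 3), (4, 0), (0, 4)}"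
  by (simp add: cycle_graph_5 undirected_def mk_symmetric_def insert_commute)

lemma cycle_5_two_K2_free: "\<not> embeds two_K2 (cycle_graph 5)"
proof -
  let ?E = "parcs (cycle_graph 5)"
  have "\<forall>(a, b)\<in>?E. \<forall>(c, d)\<in>?E.
      \<not> ((a, c) \<notin> ?E \<and> (a, d) \<notin> ?E \<and> (b, c) \<notin> ?E \<and> (b, d) \<notin> ?E)"
    by (simp add: parcs_cycle_5)
  then show ?thesis
    unfolding pair_graph.embeds_two_K2_iff[OF pair_graph_cycle_5] by blast
qed

text \<open>The 5-cycle has no 4-cycle at all, induced or not, so the check over pairs of arcs
  ignores the diagonals.\<close>

lemma cycle_5_C4_free: "\<not> embeds (cycle_graph 4) (cycle_graph 5)"
proof -
  let ?E = "parcs (cycle_graph 5)"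
  have "\<forall>(a, b)\<in>?E. \<forall>(c, d)\<in>?E.
      \<not> ((b, c) \<in> ?E \<and> (d, a) \<in> ?E \<and> a \<noteq> c \<and> b \<noteq> d)"
    by (simp add: parcs_cycle_5)
  then show ?thesis
    unfolding pair_graph.embeds_C4_iff[OF pair_graph_cycle_5] by blast
qed

text \<open>The kite contains a triangle and the 5-cycle does not.\<close>

lemma cycle_5_kite_free: "\<not> embeds kite (cycle_graph 5)"
proof -
  let ?E = "parcs (cycle_graph 5)"
  have "\<forall>(x, y)\<in>?E. \<forall>(z, y')\<in>?E. y' = y \<longrightarrow> (z, x) \<notin> ?E"
    by (simp add: parcs_cycle_5)
  then show ?thesis
    unfolding pair_graph.embeds_kite_iff[OF pair_graph_cycle_5]
    using pair_graph.adj_sym[OF pair_graph_cycle_5] by blast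
qed

section \<open>Compositions, their components, and indecomposable induced subgraphs\<close>

lemma pair_graph_compose:
  assumes "splitted_graph S" "pair_graph H" "pverts (fst S) \<inter> pverts H = {}"
  shows "pair_graph (S \<odot> H)"
proof (cases S)
  case (fields G A B)
  then show ?thesis
    using assms by (auto simp: pair_graph_iff split_partition_def irrefl_def sym_def)
qed

lemma pverts_compose [simp]: "pverts (S \<odot> H) = pverts (fst S) \<union> pverts H"
  by (cases S) auto

text \<open>Every arc added by the composition joins the two operands, so no adjacency changes
  inside either of them.\<close>

lemma induced_compose:
  assumes "splitted_graph S" "pair_graph H" "pverts (fst S) \<inter> pverts H = {}"
  shows "induced (S \<odot> H) (pverts (fst S)) = fst S"
    and "W \<subseteq> pverts H \<Longrightarrow> induced (S \<odot> H) W = induced H W"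
  using assms
  by (cases S; auto simp: induced_def pair_graph_iff split_partition_def
      intro!: pair_pre_digraph.equality)+

lemma components_Cons: "components (S # Ss) G0 = fst S # components Ss G0"
  by (simp add: components_def)

text \<open>Through this, a component inherits the absence of forbidden induced subgraphs from the
  whole graph.\<close>

lemma components_induced:
  assumes "\<forall>S\<in>set Ss. splitted_graph S" "pair_graph G0"
    "sorted_wrt disjnt (map pverts (components Ss G0))"
  shows "pair_graph (foldr (\<odot>) Ss G0) \<and>
    pverts (foldr (\<odot>) Ss G0) = (\<Union>H\<in>set (components Ss G0). pverts H) \<and>
    (\<forall>H\<in>set (components Ss G0). induced (foldr (\<odot>) Ss G0) (pverts H) = H)"
  using assms
proof (induction Ss)
  case Nil
  then show ?case
    by (auto simp: components_def induced_def pair_graph_iff intro!: pair_pre_digraph.equality)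
next
  case (Cons S Ss)
  let ?G = "foldr (\<odot>) Ss G0"
  have IH: "pair_graph ?G" "pverts ?G = (\<Union>H\<in>set (components Ss G0). pverts H)"
    "\<forall>H\<in>set (components Ss G0). induced ?G (pverts H) = H"
    using Cons by (auto simp: components_Cons)
  have S: "splitted_graph S"
    using Cons.prems by simp
  have disj: "pverts (fst S) \<inter> pverts ?G = {}"
    using Cons.prems(3) IH(2) by (auto simp: components_Cons disjnt_def)
  have "induced (S \<odot> ?G) (pverts H) = H" if H: "H \<in> set (components Ss G0)" for H
    using induced_compose(2)[OF S IH(1) disj, of "pverts H"] IH(2,3) H by auto
  then show ?case
    using pair_graph_compose[OF S IH(1) disj] induced_compose(1)[OF S IH(1) disj] IH(2)
    by (simp add: components_Cons)
qed

text \<open>A copy of \<open>X\<close> that meets both operands inherits a decomposition: the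
  preimages of \<open>A\<close> and \<open>B\<close> are independent and a clique, and the vertices
  mapped into \<open>H\<close> see none of the former and all of the latter.\<close>

lemma embeds_compose:
  assumes S: "splitted_graph (S, A, B)" and H: "pair_graph H" and X: "pair_graph X"
    and disj: "pverts S \<inter> pverts H = {}"
    and emb: "embeds X ((S, A, B) \<odot> H)" and indec: "\<not> decomposable X"
  shows "embeds X S \<or> embeds X H"
proof -
  let ?G = "(S, A, B) \<odot> H"
  obtain f where inj: "inj_on f (pverts X)" and V: "f ` pverts X \<subseteq> pverts ?G"
    and E: "\<And>u v. u \<in> pverts X \<Longrightarrow> v \<in> pverts X \<Longrightarrow> (u, v) \<in> parcs X \<longleftrightarrow> (f u, f v) \<in> parcs ?G"
    using emb unfolding embeds_def by blast
  have wf: "parcs S \<subseteq> pverts S \<times> pverts S" "parcs H \<subseteq> pverts H \<times> pverts H"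
    and AB: "A \<union> B = pverts S" "A \<inter> B = {}" "independent_set S A" "clique S B"
    using S H by (auto simp: pair_graph_iff split_partition_def)
  define P where "P = {u \<in> pverts X. f u \<in> A}"
  define Q where "Q = {u \<in> pverts X. f u \<in> B}"
  \<comment> \<open>The copy lies inside \<open>H\<close>, lies inside \<open>S\<close>, or meets
    both.\<close>
  consider "P \<union> Q = {}" | "P \<union> Q = pverts X" | "P \<union> Q \<noteq> {}" "P \<union> Q \<noteq> pverts X"
    by blast
  then show ?thesis
  proof cases
    case 1
    then have "f ` pverts X \<subseteq> pverts H"
      using V AB(1)[symmetric] by (auto simp: P_def Q_def)
    moreover from this have "f u \<in> pverts H" if "u \<in> pverts X" for u
      using that by blast
    then have "(f u, f v) \<in> parcs ?G \<longleftrightarrow> (f u, f v) \<in> parcs H"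
      if "u \<in> pverts X" "v \<in> pverts X" for u v
      using that wf AB disj by auto
    ultimately have "embeds X H"
      using inj E unfolding embeds_def by (intro exI[of _ f]) blast
    then show ?thesis ..
  next
    case 2
    then have "f ` pverts X \<subseteq> pverts S"
      using AB by (auto simp: P_def Q_def)
    moreover from this have "f u \<in> pverts S" if "u \<in> pverts X" for u
      using that by blast
    then have "(f u, f v) \<in> parcs ?G \<longleftrightarrow> (f u, f v) \<in> parcs S"
      if "u \<in> pverts X" "v \<in> pverts X" for u v
      using that wf disj by auto
    ultimately have "embeds X S"
      using inj E unfolding embeds_def by (intro exI[of _ f]) blast
    then show ?thesis ..
  next
    case 3
    have out: "f v \<in> pverts H" if "v \<in> pverts X - (P \<union> Q)" for v
      using that V AB(1)[symmetric] by (auto simp: P_def Q_def)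
    have "independent_set X P"
      using AB disj wf by (fastforce simp: P_def independent_set_def E)
    moreover have "clique X Q"
      using AB by (auto simp: Q_def clique_def E inj_on_eq_iff[OF inj])
    moreover have "P \<inter> Q = {}"
      using AB by (auto simp: P_def Q_def)
    moreover have "(a, v) \<notin> parcs X" if "v \<in> pverts X - (P \<union> Q)" "a \<in> P" for a v
      using out[OF that(1)] that AB disj wf E[of a v] by (auto simp: P_def)
    moreover have "(b, v) \<in> parcs X" if "v \<in> pverts X - (P \<union> Q)" "b \<in> Q" for b v
      using out[OF that(1)] that E[of b v] by (auto simp: Q_def)
    ultimately have "decomposable X"
      using 3 unfolding decomposable_iff[OF X] by blast
    with indec show ?thesis ..
  qed
qed

lemma embeds_foldr_compose:
  assumes "pair_graph X" "\<not> decomposable X"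
    and "\<forall>S\<in>set Ss. splitted_graph S" "pair_graph G0"
    "sorted_wrt disjnt (map pverts (components Ss G0))"
    and "embeds X (foldr (\<odot>) Ss G0)"
  shows "\<exists>H\<in>set (components Ss G0). embeds X H"
  using assms(3-)
proof (induction Ss)
  case Nil
  then show ?case
    by (simp add: components_def)
next
  case (Cons S Ss)
  obtain K A B where K: "S = (K, A, B)"
    by (cases S)
  let ?G = "foldr (\<odot>) Ss G0"
  have *: "\<forall>S\<in>set Ss. splitted_graph S" "sorted_wrt disjnt (map pverts (components Ss G0))"
    using Cons.prems by (auto simp: components_Cons)
  have "pair_graph ?G" "pverts ?G = (\<Union>H\<in>set (components Ss G0). pverts H)"
    using components_induced[OF *(1) \<open>pair_graph G0\<close> *(2)] by auto
  moreover from this have "pverts K \<inter> pverts ?G = {}"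
    using Cons.prems(3) K by (auto simp: components_Cons disjnt_def)
  ultimately have "embeds X K \<or> embeds X ?G"
    using embeds_compose[of K A B ?G X] Cons.prems assms(1,2) K by simp
  then show ?case
    using Cons.IH * \<open>pair_graph G0\<close> K by (auto simp: components_Cons)
qed

section \<open>The theorem of Foeldes and Hammer on split graphs\<close>

context pair_graph
begin

text \<open>There are finitely many cliques, and the empty set is one of them. The weight is left
  arbitrary here and is chosen in the theorem below.\<close>

lemma ex_max_clique:
  fixes w :: "'a \<Rightarrow> nat"
  obtains K where "clique G K"
    and "\<And>K'. clique G K' \<Longrightarrow> sum w K' \<le> sum w K"
proof -
  let ?C = "{K. clique G K}"
  have "?C \<subseteq> Pow (pverts G)"
    by (auto simp: clique_def)
  then have fin: "finite (sum w ` ?C)"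
    using pair_finite_verts by (meson finite_Pow_iff finite_imageI finite_subset)
  moreover have "clique G {}"
    by (simp add: clique_def)
  then have "sum w ` ?C \<noteq> {}"
    by blast
  ultimately have "Max (sum w ` ?C) \<in> sum w ` ?C"
    by (rule Max_in)
  then obtain K where "clique G K" and K: "sum w K = Max (sum w ` ?C)"
    by auto
  moreover have "sum w K' \<le> sum w K" if "clique G K'" for K'
    unfolding K using fin that by (intro Max_ge) auto
  ultimately show thesis
    using that by blast
qed

text \<open>The clique is chosen to maximise the sum of \<open>deg v + 1\<close> over its vertices. Hence it is
  maximal under inclusion, and exchanging one of its vertices for an outside vertex that is
  adjacent to all its other vertices does not increase the degree.\<close>

theorem split_if_two_K2_C4_C5_free:
  assumes no_two_K2: "\<And>a b c d. a \<sim> b \<Longrightarrow> c \<sim> d \<Longrightarrow>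
      \<not> a \<sim> c \<Longrightarrow> \<not> a \<sim> d \<Longrightarrow> \<not> b \<sim> c \<Longrightarrow> \<not> b \<sim> d \<Longrightarrow> False"
    and no_C4: "\<And>a b c d. a \<sim> b \<Longrightarrow> b \<sim> c \<Longrightarrow> c \<sim> d \<Longrightarrow> d \<sim> a \<Longrightarrow>
      \<not> a \<sim> c \<Longrightarrow> \<not> b \<sim> d \<Longrightarrow> a \<noteq> c \<Longrightarrow> b \<noteq> d \<Longrightarrow> False"
    and no_C5: "\<And>a b c d e. \<not> is_C5 a b c d e"
  shows "split_graph G"
proof -
  define N where "N v = {u. v \<sim> u}" for v
  have finN: "finite (N v)" for v
    by (rule finite_subset[OF _ pair_finite_verts]) (auto simp: N_def dest: in_arcsD2)
  define w where "w v = card (N v) + 1" for v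
  obtain K where K: "clique G K" and max: "\<And>K'. clique G K' \<Longrightarrow> sum w K' \<le> sum w K"
    using ex_max_clique[of w] by blast
  have KV: "K \<subseteq> pverts G" and adjK: "\<And>u v. u \<in> K \<Longrightarrow> v \<in> K \<Longrightarrow> u \<noteq> v \<Longrightarrow> u \<sim> v"
    using K by (auto simp: clique_def)
  have finK: "finite K"
    using KV pair_finite_verts by (rule finite_subset)
  have nonnb: "\<exists>u\<in>K. \<not> x \<sim> u" if x: "x \<in> pverts G" "x \<notin> K" for x
  proof (rule ccontr)
    assume "\<not> ?thesis"
    then have "clique G (insert x K)"
      using x K arcs_symmetric by (auto simp: clique_def)
    from max[OF this] show False
      using finK x by (simp add: w_def)
  qed
  have exchange: "\<exists>t. u \<sim> t \<and> \<not> x \<sim> t \<and> t \<notin> K"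
    if x: "x \<in> pverts G" "x \<notin> K" and u: "u \<in> K" "\<not> x \<sim> u"
      and others: "\<And>v. v \<in> K \<Longrightarrow> v \<noteq> u \<Longrightarrow> x \<sim> v" and y: "x \<sim> y" "\<not> y \<sim> u" for x u y
  proof -
    have "clique G (insert x (K - {u}))"
      using x K others arcs_symmetric by (auto simp: clique_def)
    from max[OF this] have "w x + sum w (K - {u}) \<le> sum w K"
      using finK x by simp
    also have "\<dots> = w u + sum w (K - {u})"
      using finK u by (simp add: sum.remove)
    finally have "card (N x) \<le> card (N u)"
      by (simp add: w_def)
    \<comment> \<open>Since \<open>y\<close> is a neighbour of \<open>x\<close> but not of
      \<open>u\<close>, and \<open>x\<close> has no more neighbours than \<open>u\<close>, some
      neighbour \<open>t\<close> of \<open>u\<close> is missed by \<open>x\<close>.\<close>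
    moreover have "y \<in> N x" "y \<notin> N u"
      using y adj_sym by (auto simp: N_def)
    ultimately have "\<not> N u \<subseteq> N x"
      using finN card_mono card_subset_eq by (metis le_antisym)
    then obtain t where "u \<sim> t" "\<not> x \<sim> t"
      by (auto simp: N_def)
    moreover from this have "t \<notin> K"
      using others[of t] by (cases "t = u") auto
    ultimately show ?thesis
      by blast
  qed
  \<comment> \<open>It remains to exclude an edge \<open>x\<close>, \<open>y\<close> outside
    \<open>K\<close>. The cases are distinguished by which vertices of \<open>K\<close> the two ends
    miss.\<close>
  have False if xy: "x \<sim> y" "x \<notin> K" "y \<notin> K" for x y
  proof -
    have V: "x \<in> pverts G" "y \<in> pverts G"
      using xy in_arcsD1 in_arcsD2 by auto
    \<comment> \<open>Both ends miss \<open>u\<close>, and \<open>y\<close> alone misses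
      \<open>v\<close>. Then \<open>x\<close> misses only \<open>u\<close> in \<open>K\<close>, so
      an exchange gives \<open>t\<close>, which is adjacent to \<open>y\<close> because there is no
      \<open>2K_2\<close>. Depending on whether \<open>t\<close> is adjacent to \<open>v\<close>,
      either \<open>x, y, t, v\<close> is a 4-cycle or \<open>x, y, t, u, v\<close> is a
      5-cycle.\<close>
    have key: False if xy: "x \<sim> y" "x \<notin> K" "y \<notin> K"
      and uv: "u \<in> K" "v \<in> K" "u \<noteq> v" "\<not> x \<sim> u" "\<not> y \<sim> u" "\<not> y \<sim> v" "x \<sim> v" for x y u v
    proof -
      have x: "x \<in> pverts G"
        using xy in_arcsD1 by blast
      have others: "x \<sim> k" if k: "k \<in> K" "k \<noteq> u" for k
      proof (rule ccontr)
        assume xk: "\<not> x \<sim> k"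
        have "u \<sim> k" "k \<noteq> v"
          using adjK k uv xk by auto
        then have "y \<sim> k"
          using no_two_K2[of x y u k] xy uv xk by blast
        moreover have "k \<sim> v"
          using adjK k uv \<open>k \<noteq> v\<close> by blast
        ultimately show False
          using no_C4[of x y k v] xy uv xk k adj_sym by metis
      qed
      obtain t where t: "u \<sim> t" "\<not> x \<sim> t" "t \<notin> K"
        using exchange[OF x _ uv(1,4) others xy(1) uv(5)] xy by blast
      have "u \<sim> v"
        using adjK uv by blast
      have ty: "t \<sim> y"
        using no_two_K2[of x y u t] xy uv t adj_sym by blast
      show False
      proof (cases "t \<sim> v")
        case True
        then show False
          using no_C4[of x y t v] xy uv t ty adj_sym by metis
      next
        case False
        then have "is_C5 x y t u v"
          using xy uv t ty \<open>u \<sim> v\<close> adj_sym unfolding is_C5_def by blast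
        then show False
          using no_C5 by blast
      qed
    qed
    \<comment> \<open>Both ends miss exactly \<open>z\<close>. Exchanging \<open>z\<close> for
      \<open>x\<close> and for \<open>y\<close> yields \<open>t\<close> and \<open>t'\<close>, and
      \<open>x, y, t, z, t'\<close> closes up to an induced 5-cycle, unless
      \<open>x, y, t, t'\<close> is already an induced 4-cycle.\<close>
    have same: False if z: "z \<in> K" "\<And>v. v \<in> K \<Longrightarrow> x \<sim> v \<longleftrightarrow> v \<noteq> z" "\<And>v. v \<in> K \<Longrightarrow> y \<sim> v \<longleftrightarrow> v \<noteq> z" for z
    proof -
      have nz: "\<not> x \<sim> z" "\<not> y \<sim> z"
        using z by auto
      obtain t where t: "z \<sim> t" "\<not> x \<sim> t" "t \<notin> K"
        using exchange[of x z y] V xy z nz by blast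
      obtain t' where t': "z \<sim> t'" "\<not> y \<sim> t'" "t' \<notin> K"
        using exchange[of y z x] V xy z nz adj_sym by blast
      have ty: "t \<sim> y"
        using no_two_K2[of x y z t] xy t nz adj_sym by blast
      have tx: "t' \<sim> x"
        using no_two_K2[of x y z t'] xy t' nz adj_sym by blast
      have "\<not> t \<sim> t'"
        using no_C4[of x y t t'] xy t t' ty tx nz adj_sym by metis
      then have "is_C5 x y t z t'"
        using xy t t' ty tx nz adj_sym unfolding is_C5_def by blast
      then show False
        using no_C5 by blast
    qed
    obtain u where u: "u \<in> K" "\<not> x \<sim> u"
      using nonnb V xy by blast
    obtain v where v: "v \<in> K" "\<not> y \<sim> v"
      using nonnb V xy by blast
    have distinct: False if uv: "u \<in> K" "\<not> x \<sim> u" "v \<in> K" "\<not> y \<sim> v" "u \<noteq> v" for u v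
    proof -
      have "u \<sim> v"
        using adjK uv by blast
      consider "x \<sim> v" "y \<sim> u" | "x \<sim> v" "\<not> y \<sim> u" | "\<not> x \<sim> v" "y \<sim> u" | "\<not> x \<sim> v" "\<not> y \<sim> u"
        by blast
      then show False
      proof cases
        case 1
        then show False
          using no_C4[of x v u y] xy uv \<open>u \<sim> v\<close> adj_sym by metis
      next
        case 2
        then show False
          using key[of x y u v] xy uv by blast
      next
        case 3
        then show False
          using key[of y x v u] xy uv adj_sym by blast
      next
        case 4
        then show False
          using no_two_K2[of x y u v] xy uv \<open>u \<sim> v\<close> by blast
      qed
    qed
    \<comment> \<open>By \<open>distinct\<close>, any vertex of \<open>K\<close> missed by
      \<open>x\<close> equals any vertex of \<open>K\<close> missed by \<open>y\<close>. Hence both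
      miss exactly one vertex, the same one.\<close>
    then show False
      using same[of u] u v by metis
  qed
  then have "split_partition G (pverts G - K) K"
    using K KV by (auto simp: split_partition_def independent_set_def)
  then show ?thesis
    using pair_graph by (auto simp: split_graph_def)
qed

section \<open>Indecomposable graphs with an induced 5-cycle\<close>

text \<open>If \<open>v\<close> is adjacent to \<open>a\<close> but not to \<open>b\<close>, then
  excluding 4-cycles and \<open>2K_2\<close> in turn settles its adjacency to \<open>c\<close>,
  \<open>d\<close> and \<open>e\<close>, after which the edges \<open>bc\<close> and
  \<open>ve\<close> form a \<open>2K_2\<close>. Applied to all rotations, this carries adjacency
  once around the cycle.\<close>

lemma C5_neighbour:
  assumes no_two_K2: "\<not> embeds two_K2 G" and no_C4: "\<not> embeds (cycle_graph 4) G"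
    and C5: "is_C5 a b c d e" and v: "v \<notin> {a, b, c, d, e}" "v \<sim> a"
  shows "v \<sim> b"
proof (rule ccontr)
  assume vb: "\<not> v \<sim> b"
  note C = C5[unfolded is_C5_def]
  have two: False if "p \<sim> q" "r \<sim> s" "\<not> p \<sim> r" "\<not> p \<sim> s" "\<not> q \<sim> r" "\<not> q \<sim> s" for p q r s
    using no_two_K2 that unfolding embeds_two_K2_iff by blast
  have four: False if "p \<sim> q" "q \<sim> r" "r \<sim> s" "s \<sim> p" "\<not> p \<sim> r" "\<not> q \<sim> s" "p \<noteq> r" "q \<noteq> s" for p q r s
    using no_C4 that unfolding embeds_C4_iff by blast
  have dist: "distinct [a, b, c, d, e]"
    using C5 by (rule is_C5_distinct)
  have vc: "\<not> v \<sim> c"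
    using four[of v a b c] C v vb dist adj_sym by auto
  then have vd: "v \<sim> d"
    using two[of v a c d] C v adj_sym by blast
  then have ve: "v \<sim> e"
    using four[of v a e d] C v dist adj_sym by auto
  show False
    using two[of b c v e] C vb vc ve adj_sym by blast
qed

lemma C5_if_indecomposable:
  assumes no_two_K2: "\<not> embeds two_K2 G" and no_C4: "\<not> embeds (cycle_graph 4) G"
    and indec: "\<not> decomposable G" and C5: "is_C5 a b c d e"
  shows "graph_iso G (cycle_graph 5)"
proof -
  let ?C = "{a, b, c, d, e}"
  define Q where "Q = {v \<in> pverts G - ?C. v \<sim> a}"
  define P where "P = {v \<in> pverts G - ?C. \<not> v \<sim> a}"
  note C = C5[unfolded is_C5_def]
  have CV: "?C \<subseteq> pverts G"
    using C in_arcsD1 in_arcsD2 by blast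
  note nb = C5_neighbour[OF no_two_K2 no_C4]
  note C5s = C5 is_C5_rotate[OF C5] is_C5_rotate[OF is_C5_rotate[OF C5]]
    is_C5_rotate[OF is_C5_rotate[OF is_C5_rotate[OF C5]]]
    is_C5_rotate[OF is_C5_rotate[OF is_C5_rotate[OF is_C5_rotate[OF C5]]]]
  \<comment> \<open>The five implications form a closed chain, so an outside vertex sees all of the
    cycle or nothing of it.\<close>
  have step: "v \<sim> a \<longrightarrow> v \<sim> b" "v \<sim> b \<longrightarrow> v \<sim> c" "v \<sim> c \<longrightarrow> v \<sim> d" "v \<sim> d \<longrightarrow> v \<sim> e" "v \<sim> e \<longrightarrow> v \<sim> a"
    if "v \<notin> ?C" for v
    using that nb[OF C5s(1), of v] nb[OF C5s(2), of v] nb[OF C5s(3), of v]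
      nb[OF C5s(4), of v] nb[OF C5s(5), of v] by auto
  have Q: "v \<sim> x" if "v \<in> Q" "x \<in> ?C" for v x
    using that step[of v] by (auto simp: Q_def)
  have P: "\<not> v \<sim> x" if "v \<in> P" "x \<in> ?C" for v x
    using that step[of v] by (auto simp: P_def)
  have "independent_set G P"
    unfolding independent_set_def
  proof (intro conjI ballI notI)
    fix u v assume "u \<in> P" "v \<in> P" "u \<sim> v"
    then show False
      using no_two_K2 C P[of u] P[of v] unfolding embeds_two_K2_iff by blast
  qed (auto simp: P_def)
  moreover have "clique G Q"
    unfolding clique_def
  proof (intro conjI ballI impI)
    fix u v assume uv: "u \<in> Q" "v \<in> Q" "u \<noteq> v"
    \<comment> \<open>If \<open>u\<close> and \<open>v\<close> were non-adjacent, they would form an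
      induced 4-cycle with the non-adjacent cycle vertices \<open>a\<close> and
      \<open>c\<close>.\<close>
    have "a \<noteq> c"
      using is_C5_distinct[OF C5] by simp
    moreover have "u \<sim> a" "a \<sim> v" "v \<sim> c" "c \<sim> u" "\<not> a \<sim> c"
      using uv Q C adj_sym by blast+
    ultimately show "u \<sim> v"
      using no_C4 uv unfolding embeds_C4_iff by blast
  qed (auto simp: Q_def)
  moreover have "P \<inter> Q = {}" "P \<union> Q \<noteq> pverts G" and rest: "pverts G - (P \<union> Q) = ?C"
    using CV by (auto simp: P_def Q_def)
  moreover have "\<forall>v\<in>pverts G - (P \<union> Q). (\<forall>u\<in>P. \<not> u \<sim> v) \<and> (\<forall>u\<in>Q. u \<sim> v)"
    unfolding rest using P Q by blast
  ultimately have "P \<union> Q = {}"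
    using indec decomposable_iff[OF pair_graph] by meson
  then have "pverts G = ?C"
    using rest by simp
  then show ?thesis
    using is_C5_embedding[OF C5] unfolding graph_iso_iff[OF pair_graph pair_graph_cycle_5] by simp
qed

end

theorem split_or_C5:
  assumes "pair_graph G" "\<not> decomposable G"
    and "\<not> embeds two_K2 G" "\<not> embeds (cycle_graph 4) G"
  shows "split_graph G \<or> graph_iso G (cycle_graph 5)"
proof -
  interpret pair_graph G by fact
  show ?thesis
  proof (cases "\<exists>a b c d e. is_C5 a b c d e")
    case True
    then show ?thesis
      using C5_if_indecomposable assms by blast
  next
    case False
    then show ?thesis
      using split_if_two_K2_C4_C5_free assms(3,4)
      unfolding embeds_two_K2_iff embeds_C4_iff by blast
  qed
qed

lemma embeds_iso_C5:
  assumes "pair_graph G" "graph_iso G (cycle_graph 5)" "pair_graph X" "embeds X G"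
  shows "embeds X (cycle_graph 5)"
proof -
  obtain f where f: "bij_betw f (pverts (cycle_graph 5)) (pverts G)"
    and iff: "\<And>u v. u \<in> pverts (cycle_graph 5) \<Longrightarrow> v \<in> pverts (cycle_graph 5) \<Longrightarrow>
      (u, v) \<in> parcs (cycle_graph 5) \<longleftrightarrow> (f u, f v) \<in> parcs G"
    using assms(2) unfolding graph_iso_iff[OF assms(1) pair_graph_cycle_5] by blast
  obtain h where h: "inj_on h (pverts X)" "h ` pverts X \<subseteq> pverts G"
    "\<And>u v. u \<in> pverts X \<Longrightarrow> v \<in> pverts X \<Longrightarrow> (u, v) \<in> parcs X \<longleftrightarrow> (h u, h v) \<in> parcs G"
    using assms(4) unfolding embeds_def by blast
  define g where "g = the_inv_into (pverts (cycle_graph 5)) f"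
  have g: "bij_betw g (pverts G) (pverts (cycle_graph 5))" "\<And>v. v \<in> pverts G \<Longrightarrow> f (g v) = v"
    using f by (auto simp: g_def bij_betw_the_inv_into f_the_inv_into_f_bij_betw)
  have gV: "g v \<in> pverts (cycle_graph 5)" if "v \<in> pverts G" for v
    using g(1) that by (auto simp: bij_betw_def)
  have hV: "h u \<in> pverts G" if "u \<in> pverts X" for u
    using h(2) that by blast
  have "inj_on (g \<circ> h) (pverts X)"
    using h g(1) by (intro comp_inj_on) (auto simp: bij_betw_def intro: inj_on_subset)
  moreover have "(u, v) \<in> parcs X \<longleftrightarrow> (g (h u), g (h v)) \<in> parcs (cycle_graph 5)"
    if "u \<in> pverts X" "v \<in> pverts X" for u v
    using that h(3) iff[of "g (h u)" "g (h v)"] g(2) gV hV by simp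
  ultimately show ?thesis
    using gV hV unfolding embeds_def by (intro exI[of _ "g \<circ> h"]) auto
qed

section \<open>Indecomposable kite-free split graphs are bottom-expanded spiders\<close>

context pair_graph
begin

abbreviation nbs :: "'a \<Rightarrow> 'a set" where
  "nbs v \<equiv> parcs G `` {v}"

text \<open>Vertices of \<open>A\<close> with the same value under \<open>f\<close> have the same
  neighbourhood. One representative of each class, together with \<open>B\<close>, forms a headless
  spider; substituting for each representative the edgeless graph on its class then rebuilds
  \<open>G\<close>.\<close>

lemma bottom_expanded_spiderI:
  assumes part: "split_partition G A B" and f: "f ` A = B" and B: "card B \<ge> 2"
    and nbs: "(\<forall>a\<in>A. nbs a = {f a}) \<or> (\<forall>a\<in>A. nbs a = B - {f a})"
  shows "bottom_expanded_spider G"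
proof -
  have V: "pverts G = A \<union> B" "A \<inter> B = {}"
    and indep: "\<And>u v. u \<in> A \<Longrightarrow> v \<in> A \<Longrightarrow> \<not> u \<sim> v"
    and clq: "\<And>u v. u \<in> B \<Longrightarrow> v \<in> B \<Longrightarrow> u \<noteq> v \<Longrightarrow> u \<sim> v"
    using part by (auto simp: split_partition_def independent_set_def clique_def)
  obtain R where R: "R \<subseteq> A" "inj_on f R" "f ` R = B"
    using subset_image_inj[of B f A] f by auto
  have finR: "finite R"
    by (rule finite_subset[OF _ pair_finite_verts]) (use R(1) V in auto)
  \<comment> \<open>The vertex set reached once the representatives in \<open>Q\<close> have been
    expanded. The induction on \<open>Q\<close> keeps \<open>R - Q\<close> as the set of feet still
    available for substitution.\<close>
  define W where "W Q = B \<union> R \<union> {a \<in> A. f a \<in> f ` Q}" for Q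
  have "foot_expansion (induced G (W Q)) (R - Q)" if "Q \<subseteq> R" for Q
    using finite_subset[OF that finR] that
  proof (induction Q)
    case empty
    have W: "W {} = B \<union> R"
      by (simp add: W_def)
    have "bij_betw f R B"
      using R by (simp add: bij_betw_def)
    moreover from this have "card R = card B"
      by (rule bij_betw_same_card)
    moreover have "pair_graph (induced G (W {}))"
      using pair_graph by (rule pair_graph_induced) (use W R V in auto)
    moreover have "split_partition (induced G (W {})) R B"
      using R(1)[THEN subsetD] V(2) indep clq
      by (auto simp: W split_partition_def independent_set_def clique_def)
    moreover have "parcs (induced G (W {})) `` {v} = nbs v" if "v \<in> R" for v
    proof -
      have "nbs v \<subseteq> B"
        using nbs f R(1) that by blast
      then show ?thesis
        using that by (auto simp: W)
    qed
    then have "(\<forall>v\<in>R. parcs (induced G (W {})) `` {v} = {f v}) \<or>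
      (\<forall>v\<in>R. parcs (induced G (W {})) `` {v} = B - {f v})"
      using nbs R(1) by (metis subsetD)
    ultimately have "headless_spider (induced G (W {})) R B"
      using B unfolding headless_spider_def by auto
    then show ?case
      by (simp add: foot_expansion.spider)
  next
    case (insert r Q)
    let ?J = "induced G (W Q)"
    define C where "C = {a \<in> A. f a = f r}"
    define H where "H = \<lparr>pverts = C, parcs = {} :: ('a \<times> 'a) set\<rparr>"
    have r: "r \<in> R" "r \<notin> Q" "Q \<subseteq> R"
      using insert by auto
    have fr: "f r \<notin> f ` Q"
      using r R(2) by (auto dest: inj_onD)
    \<comment> \<open>The class \<open>C\<close> contains the foot \<open>r\<close> that it
      replaces, and nothing else of it is present yet. This is the disjointness required by
      \<open>expand\<close>.\<close>
    have CW: "C \<inter> W Q = {r}"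
    proof -
      have "f a \<notin> f ` Q" "a \<notin> B" if "a \<in> C" for a
        using that fr V by (auto simp: C_def)
      moreover have "a = r" if "a \<in> C" "a \<in> R" for a
        using that r R(2) by (auto simp: C_def dest: inj_onD)
      moreover have "r \<in> C"
        using r R(1) by (auto simp: C_def)
      ultimately show ?thesis
        using r(1) unfolding W_def by blast
    qed
    have WQ: "W (insert r Q) = C \<union> W Q"
      unfolding C_def W_def by auto
    have "r \<in> C"
      using r R by (auto simp: C_def)
    have nbsC: "nbs v = nbs r" if "v \<in> C" for v
      using that nbs \<open>r \<in> C\<close> unfolding C_def by (metis (mono_tags, lifting) mem_Collect_eq)
    have nbsr: "nbs r \<subseteq> B"
      using nbs \<open>r \<in> C\<close> f unfolding C_def by blast
    have BW: "B \<subseteq> W Q"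
      by (auto simp: W_def)
    have CA: "C \<subseteq> A"
      by (auto simp: C_def)
    have "foot_expansion (substitute ?J r H) (R - Q - {r})"
    proof (rule foot_expansion.expand)
      show "foot_expansion ?J (R - Q)"
        using insert by simp
      have "finite C"
        using V pair_finite_verts by (auto simp: C_def)
      then show "pair_graph H"
        by (simp add: pair_graph_iff H_def sym_def irrefl_def)
    qed (use r CW \<open>r \<in> C\<close> in \<open>auto simp: H_def\<close>)
    moreover have "substitute ?J r H = induced G (W (insert r Q))"
    proof (rule pair_pre_digraph.equality)
      have nbsJ: "parcs ?J `` {r} = nbs r"
        using nbsr BW CW by auto
      have inC: "u \<sim> v \<longleftrightarrow> v \<in> nbs r" if "u \<in> C" for u v
        using nbsC[OF that] by auto
      have inC': "v \<sim> u \<longleftrightarrow> v \<in> nbs r" if "u \<in> C" for u v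
        using inC[OF that] adj_sym by blast
      have "(u, v) \<in> parcs (substitute ?J r H) \<longleftrightarrow> (u, v) \<in> parcs (induced G (W (insert r Q)))"
        for u v
      proof -
        have rC: "x \<in> C" if "x = r" for x
          using that \<open>r \<in> C\<close> by simp
        have *: "x \<in> W Q \<and> x \<noteq> r \<longleftrightarrow> x \<in> C \<union> W Q \<and> x \<notin> C" for x
          using CW by blast
        have nC: "x \<notin> C" if "x \<in> nbs r" for x
          using that nbsr CA V by blast
        have nW: "x \<in> W Q" if "x \<in> nbs r" for x
          using that nbsr BW by blast
        have "(u, v) \<in> parcs (substitute ?J r H) \<longleftrightarrow>
          u \<sim> v \<and> (u \<in> W Q \<and> u \<noteq> r) \<and> (v \<in> W Q \<and> v \<noteq> r) \<or> u \<in> C \<and> v \<in> nbs r \<or> u \<in> nbs r \<and> v \<in> C"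
          unfolding substitute_def nbsJ by (auto simp: H_def)
        also have "\<dots> \<longleftrightarrow> u \<sim> v \<and> u \<in> C \<union> W Q \<and> v \<in> C \<union> W Q"
          unfolding * using inC[of u v] inC'[of v u] nC nW by blast
        finally show ?thesis
          by (auto simp: WQ)
      qed
      then show "parcs (substitute ?J r H) = parcs (induced G (W (insert r Q)))"
        by auto
      show "pverts (substitute ?J r H) = pverts (induced G (W (insert r Q)))"
        using CW \<open>r \<in> C\<close> by (auto simp: substitute_def H_def WQ)
    qed simp
    ultimately show ?case
      by (subst Diff_insert) (simp only:)
  qed
  from this[of R] have "foot_expansion (induced G (W R)) {}"
    by simp
  moreover have "W R = pverts G"
    using R f V by (auto simp: W_def)
  moreover have "induced G (pverts G) = G"
    by (rule pair_pre_digraph.equality) (auto dest: in_arcsD1 in_arcsD2)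
  ultimately show ?thesis
    unfolding bottom_expanded_spider_def by auto
qed

lemma bottom_expanded_spider_if_kite_free:
  assumes part: "split_partition G A B" and card: "card (pverts G) > 1"
    and indec: "\<not> decomposable G" and no_kite: "\<not> embeds kite G"
  shows "bottom_expanded_spider G"
proof -
  have V: "pverts G = A \<union> B" "A \<inter> B = {}"
    and indep: "\<And>u v. u \<in> A \<Longrightarrow> v \<in> A \<Longrightarrow> \<not> u \<sim> v"
    and clq: "\<And>u v. u \<in> B \<Longrightarrow> v \<in> B \<Longrightarrow> u \<noteq> v \<Longrightarrow> u \<sim> v"
    using part by (auto simp: split_partition_def independent_set_def clique_def)
  have fin: "finite A" "finite B"
    using V pair_finite_verts by auto
  have ne_single: "pverts G \<noteq> {v}" for v
    using card by auto
  have nbsB: "nbs a \<subseteq> B" if "a \<in> A" for a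
    using that indep V in_arcsD2 by blast
  have fin_nbs: "finite (nbs a)" if "a \<in> A" for a
    using nbsB[OF that] fin finite_subset by blast
  \<comment> \<open>Indecomposability in the form used below: if neither alternative held,
    \<open>P\<close> and \<open>Q\<close> would be the independent set and the clique of a
    decomposition.\<close>
  have link: "(\<exists>a\<in>P. \<exists>b\<in>B - Q. a \<sim> b) \<or> (\<exists>b\<in>Q. \<exists>a\<in>A - P. \<not> a \<sim> b)"
    if PQ: "P \<subseteq> A" "Q \<subseteq> B" "P \<union> Q \<noteq> {}" "P \<union> Q \<noteq> pverts G" for P Q
  proof (rule ccontr)
    assume "\<not> ?thesis"
    then have *: "\<And>a b. a \<in> P \<Longrightarrow> b \<in> B - Q \<Longrightarrow> \<not> a \<sim> b" "\<And>a b. b \<in> Q \<Longrightarrow> a \<in> A - P \<Longrightarrow> b \<sim> a"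
      using arcs_symmetric by blast+
    have "independent_set G P"
      using PQ(1)[THEN subsetD] V(1) indep by (auto simp: independent_set_def)
    moreover have "clique G Q"
      using PQ(2)[THEN subsetD] V(1) clq by (auto simp: clique_def)
    moreover have "P \<inter> Q = {}"
      using PQ(1,2) V(2) by blast
    moreover have "\<not> a \<sim> v" if "v \<in> pverts G - (P \<union> Q)" "a \<in> P" for a v
    proof (cases "v \<in> A")
      case True
      then show ?thesis
        using indep PQ(1) that(2) by blast
    next
      case False
      then have "v \<in> B - Q"
        using that V(1) by blast
      then show ?thesis
        using * that(2) by blast
    qed
    moreover have "b \<sim> v" if "v \<in> pverts G - (P \<union> Q)" "b \<in> Q" for b v
    proof (cases "v \<in> A")
      case False
      then have "v \<in> B" "b \<in> B" "b \<noteq> v"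
        using that V PQ by auto
      then show ?thesis
        using clq by blast
    qed (use that * in blast)
    ultimately have "decomposable G"
      using PQ unfolding decomposable_iff[OF pair_graph] by blast
    with indec show False ..
  qed
  \<comment> \<open>The next four facts apply \<open>link\<close> to one vertex or to all vertices
    but one; \<open>ne_single\<close> ensures that this leaves a nonempty proper part. They exclude
    vertices of either side with no neighbours, or with all possible neighbours, on the other
    side.\<close>
  have nonempty: "nbs a \<noteq> {}" if "a \<in> A" for a
    using link[of "{a}" "{}"] that ne_single by auto
  have nonfull: "nbs a \<noteq> B" if "a \<in> A" for a
  proof -
    have "(A - {a}) \<union> B \<noteq> {}" "(A - {a}) \<union> B \<noteq> pverts G"
      using that V ne_single[of a] by auto
    from link[OF _ _ this] show ?thesis
      using that by auto
  qed
  have has_nb: "\<exists>a\<in>A. b \<in> nbs a" if "b \<in> B" for b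
  proof -
    have "A \<union> (B - {b}) \<noteq> {}" "A \<union> (B - {b}) \<noteq> pverts G"
      using that V ne_single[of b] by auto
    from link[OF _ _ this] show ?thesis
      using that by auto
  qed
  have has_nonnb: "\<exists>a\<in>A. b \<notin> nbs a" if "b \<in> B" for b
    using link[of "{}" "{b}"] that ne_single by auto
  \<comment> \<open>The triangle of the kite is \<open>x, y, z\<close>; its pendant vertex is
    \<open>a'\<close>, attached to \<open>z\<close>, and \<open>a\<close> is joined to
    \<open>x\<close> and \<open>y\<close>.\<close>
  have no_kite': False
    if "a \<in> A" "a' \<in> A" "x \<in> nbs a - nbs a'" "y \<in> nbs a - nbs a'" "x \<noteq> y" "z \<in> nbs a' - nbs a"
    for a a' x y z
  proof -
    have "x \<in> B" "y \<in> B" "z \<in> B" "z \<noteq> x" "z \<noteq> y"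
      using that nbsB[of a] nbsB[of a'] by auto
    then have "z \<sim> y" "z \<sim> x" "y \<sim> x"
      using clq \<open>x \<noteq> y\<close> by metis+
    moreover have "a' \<sim> z" "\<not> a' \<sim> x" "\<not> a' \<sim> y"
      using that by auto
    moreover have "y \<sim> a" "x \<sim> a" "\<not> z \<sim> a"
      using that arcs_symmetric by auto
    moreover have "\<not> a' \<sim> a"
      using that indep by blast
    ultimately show False
      using no_kite unfolding embeds_kite_iff by blast
  qed
  have at_most_one: "card (nbs a - nbs a') \<le> 1" if "a \<in> A" "a' \<in> A" "\<not> nbs a' \<subseteq> nbs a" for a a'
  proof -
    have "x = y" if "x \<in> nbs a - nbs a'" "y \<in> nbs a - nbs a'" for x y
      using no_kite'[OF \<open>a \<in> A\<close> \<open>a' \<in> A\<close>] that \<open>\<not> nbs a' \<subseteq> nbs a\<close> by blast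
    then show ?thesis
      using card_le_Suc0_iff_eq[of "nbs a - nbs a'"] fin_nbs that by auto
  qed
  \<comment> \<open>Otherwise \<open>nbs a\<close> has at least one element outside
    \<open>nbs a'\<close>, while \<open>nbs a'\<close> has at most one outside \<open>nbs a\<close>,
    so \<open>nbs a'\<close> cannot be the larger set.\<close>
  have smaller: "nbs a \<subseteq> nbs a'" if "a \<in> A" "a' \<in> A" "card (nbs a) < card (nbs a')" for a a'
  proof (rule ccontr)
    assume nsub: "\<not> nbs a \<subseteq> nbs a'"
    then have "card (nbs a' - nbs a) \<le> 1"
      using at_most_one that by blast
    moreover have "card (nbs a - nbs a') \<ge> 1"
      using nsub fin_nbs[OF that(1)] by (simp add: Suc_le_eq card_gt_0_iff)
    moreover have "card (nbs a) = card (nbs a \<inter> nbs a') + card (nbs a - nbs a')"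
      "card (nbs a') = card (nbs a' \<inter> nbs a) + card (nbs a' - nbs a)"
      using fin_nbs that by (simp_all add: card_Int_Diff)
    ultimately show False
      using that(3) by (simp add: Int_commute)
  qed
  have same_card: "card (nbs a) = card (nbs a')" if "a \<in> A" "a' \<in> A" for a a'
  proof (rule ccontr)
    assume neq: "card (nbs a) \<noteq> card (nbs a')"
    define k where "k = Max ((\<lambda>a. card (nbs a)) ` A)"
    have k: "card (nbs a) \<le> k" if "a \<in> A" for a
      unfolding k_def using that fin by simp
    have "k \<in> (\<lambda>a. card (nbs a)) ` A"
      unfolding k_def using that fin by (intro Max_in) auto
    then obtain m where m: "m \<in> A" "card (nbs m) = k"
      by auto
    \<comment> \<open>If the sizes differ, the vertices of \<open>A\<close> with fewer than
      \<open>k\<close> neighbours can be split off together with all their neighbours: by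
      \<open>smaller\<close>, those neighbours are adjacent to every vertex of \<open>A\<close>
      attaining \<open>k\<close>. One such vertex, \<open>m\<close>, remains outside.\<close>
    define P where "P = {a \<in> A. card (nbs a) < k}"
    define Q where "Q = (\<Union>a\<in>P. nbs a)"
    have "P \<noteq> {}"
    proof -
      have "card (nbs a) < k \<or> card (nbs a') < k"
        using that neq k[of a] k[of a'] by linarith
      then show ?thesis
        using that by (auto simp: P_def)
    qed
    moreover have "m \<notin> P" "m \<notin> Q"
      using m V nbsB by (auto simp: P_def Q_def)
    moreover have "Q \<subseteq> B"
      using nbsB by (auto simp: P_def Q_def)
    moreover have "P \<subseteq> A"
      by (auto simp: P_def)
    ultimately have "(\<exists>a\<in>P. \<exists>b\<in>B - Q. a \<sim> b) \<or> (\<exists>b\<in>Q. \<exists>a\<in>A - P. \<not> a \<sim> b)"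
      using m V by (intro link) auto
    moreover have "\<not> (\<exists>a\<in>P. \<exists>b\<in>B - Q. a \<sim> b)"
      by (auto simp: Q_def)
    moreover have "a' \<sim> b" if "b \<in> Q" "a' \<in> A - P" for a' b
    proof -
      obtain a where a: "a \<in> P" "b \<in> nbs a"
        using \<open>b \<in> Q\<close> unfolding Q_def by blast
      have "card (nbs a') = k"
        using that(2) k[of a'] by (auto simp: P_def)
      then have "nbs a \<subseteq> nbs a'"
        using a that by (intro smaller) (auto simp: P_def)
      with a show ?thesis
        by blast
    qed
    ultimately show False
      by blast
  qed
  have swap: "\<exists>x. nbs a - nbs a' = {x}" if "a \<in> A" "a' \<in> A" "nbs a \<noteq> nbs a'" for a a'
  proof -
    have sub: "\<not> nbs a \<subseteq> nbs a'" "\<not> nbs a' \<subseteq> nbs a"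
      using same_card[OF that(1,2)] fin_nbs that card_subset_eq by metis+
    have "card (nbs a - nbs a') \<noteq> 0"
      using sub fin_nbs that by auto
    then have "card (nbs a - nbs a') = 1"
      using at_most_one[OF that(1,2) sub(2)] by linarith
    then show ?thesis
      by (simp add: card_1_singleton_iff)
  qed
  have uniq: "p = q"
    if "a \<in> A" "a' \<in> A" "p \<in> nbs a" "p \<notin> nbs a'" "q \<in> nbs a" "q \<notin> nbs a'" for a a' p q
  proof -
    have "nbs a \<noteq> nbs a'"
      using that by blast
    then obtain x where "nbs a - nbs a' = {x}"
      using swap \<open>a \<in> A\<close> \<open>a' \<in> A\<close> by blast
    moreover have "p \<in> nbs a - nbs a'" "q \<in> nbs a - nbs a'"
      using that by simp_all
    ultimately show ?thesis
      by simp
  qed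
  have "A \<noteq> {}"
  proof
    assume "A = {}"
    then show False
      using card V has_nb by (cases "B = {}") auto
  qed
  then obtain a where a: "a \<in> A"
    by blast
  \<comment> \<open>A neighbour \<open>b\<close> of \<open>a\<close> is missed by some
    \<open>a'\<close>, so at least two neighbourhoods occur. By \<open>swap\<close> they have the
    form \<open>insert x K\<close> and \<open>insert y K\<close>.\<close>
  obtain b where b: "b \<in> nbs a"
    using nonempty a by blast
  obtain a' where a': "a' \<in> A" "b \<notin> nbs a'"
    using has_nonnb nbsB a b by blast
  have "nbs a \<noteq> nbs a'"
    using a' b by blast
  obtain x where x: "nbs a - nbs a' = {x}"
    using swap a a' \<open>nbs a \<noteq> nbs a'\<close> by blast
  obtain y where y: "nbs a' - nbs a = {y}"
    using swap a a' \<open>nbs a \<noteq> nbs a'\<close> by metis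
  define K where "K = nbs a \<inter> nbs a'"
  have Ka: "nbs a = insert x K" and Ka': "nbs a' = insert y K" and "x \<notin> K" "y \<notin> K" "x \<noteq> y"
    using x y by (auto simp: K_def)
  have "{x, y} \<subseteq> B"
    using nbsB[OF a] nbsB[OF a'(1)] unfolding Ka Ka' by simp
  then have "card B \<ge> 2"
    using card_mono[OF fin(2), of "{x, y}"] \<open>x \<noteq> y\<close> by simp
  have KB: "K \<subseteq> B"
    using nbsB a by (auto simp: K_def)
  \<comment> \<open>Suppose \<open>nbs c\<close> misses some \<open>k\<close> in \<open>K\<close>
    and \<open>nbs d\<close> has some \<open>z\<close> outside \<open>K\<close>, \<open>x\<close>
    and \<open>y\<close>. Comparing \<open>c\<close> with \<open>a\<close> and \<open>a'\<close>
    puts both \<open>x\<close> and \<open>y\<close> into \<open>nbs c\<close>; comparing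
    \<open>d\<close> with them keeps both out of \<open>nbs d\<close>. So \<open>nbs c\<close> has
    two elements outside \<open>nbs d\<close>, against \<open>uniq\<close>.\<close>
  have dich: "(\<forall>c\<in>A. K \<subseteq> nbs c) \<or> (\<forall>c\<in>A. nbs c \<subseteq> insert x (insert y K))"
  proof (rule ccontr)
    assume "\<not> ?thesis"
    then obtain c d where c: "c \<in> A" "\<not> K \<subseteq> nbs c" and d: "d \<in> A" "\<not> nbs d \<subseteq> insert x (insert y K)"
      by blast
    obtain k where k: "k \<in> K" "k \<notin> nbs c"
      using c by blast
    obtain z where z: "z \<in> nbs d" "z \<noteq> x" "z \<noteq> y" "z \<notin> K"
      using d by blast
    have "k \<in> nbs a" "k \<in> nbs a'" "x \<in> nbs a" "y \<in> nbs a'" "k \<noteq> x" "k \<noteq> y"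
      using Ka Ka' k(1) \<open>x \<notin> K\<close> \<open>y \<notin> K\<close> by auto
    then have xyc: "x \<in> nbs c" "y \<in> nbs c"
      using uniq[OF a c(1), of k x] uniq[OF a'(1) c(1), of k y] k(2) by blast+
    have "z \<notin> nbs a" "z \<notin> nbs a'" "x \<notin> nbs a'" "y \<notin> nbs a"
      using Ka Ka' z \<open>x \<notin> K\<close> \<open>y \<notin> K\<close> \<open>x \<noteq> y\<close> by auto
    then have "x \<notin> nbs d" "y \<notin> nbs d"
      using uniq[OF d(1) a'(1), of z x] uniq[OF d(1) a, of z y] z by blast+
    then show False
      using uniq[OF c(1) d(1), of x y] xyc \<open>x \<noteq> y\<close> by blast
  qed
  have "(\<forall>c\<in>A. \<exists>z\<in>B. nbs c = {z}) \<or> (\<forall>c\<in>A. \<exists>z\<in>B. nbs c = B - {z})"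
    using dich
  proof
    assume "\<forall>c\<in>A. K \<subseteq> nbs c"
    \<comment> \<open>An element of \<open>K\<close> would be adjacent to all of
      \<open>A\<close>.\<close>
    then have "K = {}"
      using has_nonnb KB by blast
    then have "card (nbs c) = 1" if "c \<in> A" for c
      using same_card[OF that a] Ka by simp
    then have "\<exists>z\<in>B. nbs c = {z}" if "c \<in> A" for c
    proof -
      obtain z where "nbs c = {z}"
        using \<open>c \<in> A\<close> \<open>\<And>c. c \<in> A \<Longrightarrow> card (nbs c) = 1\<close> by (meson card_1_singletonE)
      moreover from this have "z \<in> B"
        using nbsB[OF that] by (metis insert_subset)
      ultimately show ?thesis
        by blast
    qed
    then show ?thesis
      by blast
  next
    assume "\<forall>c\<in>A. nbs c \<subseteq> insert x (insert y K)"
    \<comment> \<open>Every vertex of \<open>B\<close> has a neighbour in \<open>A\<close>, so the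
      common superset exhausts \<open>B\<close>. Each neighbourhood then lacks exactly one vertex of
      \<open>B\<close>, by counting.\<close>
    then have "B \<subseteq> insert x (insert y K)"
      using has_nb by blast
    moreover have "insert x (insert y K) \<subseteq> B"
      using nbsB[OF a] nbsB[OF a'(1)] unfolding Ka Ka' by simp
    ultimately have B: "B = insert x (insert y K)"
      by (rule equalityI)
    have "finite K"
      using KB fin finite_subset by blast
    have "\<exists>z\<in>B. nbs c = B - {z}" if "c \<in> A" for c
    proof -
      have "card (B - nbs c) = card B - card (nbs c)"
        using nbsB[OF that] fin_nbs[OF that] by (rule card_Diff_subset[rotated])
      also have "\<dots> = 1"
        using same_card[OF that a] \<open>finite K\<close> \<open>x \<notin> K\<close> \<open>y \<notin> K\<close> \<open>x \<noteq> y\<close> unfolding B Ka by simp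
      finally obtain z where "B - nbs c = {z}"
        by (auto simp: card_1_singleton_iff)
      then show ?thesis
        using nbsB[OF that] by blast
    qed
    then show ?thesis
      by blast
  qed
  then show ?thesis
  proof
    assume "\<forall>c\<in>A. \<exists>z\<in>B. nbs c = {z}"
    then obtain f where f: "\<And>c. c \<in> A \<Longrightarrow> f c \<in> B" "\<And>c. c \<in> A \<Longrightarrow> nbs c = {f c}"
      by metis
    have "f ` A = B"
    proof (rule equalityI)
      show "B \<subseteq> f ` A"
      proof
        fix b assume "b \<in> B"
        then obtain c where "c \<in> A" "b \<in> nbs c"
          using has_nb by blast
        then show "b \<in> f ` A"
          using f(2)[of c] by auto
      qed
    qed (use f(1) in auto)
    then show ?thesis
      using f part \<open>card B \<ge> 2\<close> by (intro bottom_expanded_spiderI[of A B f]) auto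
  next
    assume "\<forall>c\<in>A. \<exists>z\<in>B. nbs c = B - {z}"
    then obtain f where f: "\<And>c. c \<in> A \<Longrightarrow> f c \<in> B" "\<And>c. c \<in> A \<Longrightarrow> nbs c = B - {f c}"
      by metis
    \<comment> \<open>In this case \<open>f c\<close> is the vertex missed by \<open>c\<close>, so
      surjectivity comes from \<open>has_nonnb\<close> rather than from
      \<open>has_nb\<close>.\<close>
    have "f ` A = B"
    proof (rule equalityI)
      show "B \<subseteq> f ` A"
      proof
        fix b assume "b \<in> B"
        then obtain c where "c \<in> A" "b \<notin> nbs c"
          using has_nonnb by blast
        then show "b \<in> f ` A"
          using f(2)[of c] \<open>b \<in> B\<close> by auto
      qed
    qed (use f(1) in auto)
    then show ?thesis
      using f part \<open>card B \<ge> 2\<close> by (intro bottom_expanded_spiderI[of A B f]) auto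
  qed
qed

end

section \<open>Bottom-expanded spiders and split graphs avoid the forbidden graphs\<close>

text \<open>Substituted vertices inherit the neighbourhood of the foot they replace. The bijection
  of the spider is lost by expansion, but the shape of the neighbourhoods survives. Here
  \<open>A\<close> contains old and substituted feet alike, whereas \<open>F\<close> holds only the
  feet still available.\<close>

lemma foot_expansion_nbs:
  assumes "foot_expansion J F"
  shows "\<exists>A B. pair_graph J \<and> split_partition J A B \<and> F \<subseteq> A \<and>
    ((\<forall>v\<in>A. \<exists>x. parcs J `` {v} = {x}) \<or> (\<forall>v\<in>A. \<exists>x. parcs J `` {v} = B - {x}))"
  using assms
proof induction
  case (spider S A B)
  then show ?case
    unfolding headless_spider_def by blast
next
  case (expand J F v H)
  then obtain A B where J: "pair_graph J" "split_partition J A B" "F \<subseteq> A"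
    and nbs: "(\<forall>v\<in>A. \<exists>x. parcs J `` {v} = {x}) \<or> (\<forall>v\<in>A. \<exists>x. parcs J `` {v} = B - {x})"
    by blast
  interpret J: pair_graph J by fact
  let ?S = "substitute J v H"
  have v: "v \<in> A"
    using J expand by blast
  have V: "pverts J = A \<union> B" "A \<inter> B = {}"
    and indep: "\<And>u w. u \<in> A \<Longrightarrow> w \<in> A \<Longrightarrow> (u, w) \<notin> parcs J"
    and clq: "\<And>u w. u \<in> B \<Longrightarrow> w \<in> B \<Longrightarrow> u \<noteq> w \<Longrightarrow> (u, w) \<in> parcs J"
    using J by (auto simp: split_partition_def independent_set_def clique_def)
  \<comment> \<open>The substituted graph may reuse the name \<open>v\<close> of the foot it
    replaces, but no other vertex of \<open>J\<close>.\<close>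
  have disj: "x \<notin> pverts J \<or> x = v" if "x \<in> pverts H" for x
    using expand that by blast
  have nbsv: "parcs J `` {v} \<subseteq> B"
    using v V indep J.in_arcsD2 by blast
  have HB: "x \<notin> B" if "x \<in> pverts H" for x
    using disj[OF that] V v by blast
  have arcs: "parcs ?S = {(x, y) \<in> parcs J. x \<noteq> v \<and> y \<noteq> v} \<union>
    pverts H \<times> parcs J `` {v} \<union> parcs J `` {v} \<times> pverts H"
    using expand by (simp add: substitute_def)
  have verts: "pverts ?S = pverts H \<union> (pverts J - {v})"
    by (simp add: substitute_def)
  have "finite (pverts ?S)"
    using expand J by (auto simp: verts pair_graph_iff)
  moreover have "parcs J \<subseteq> pverts J \<times> pverts J" "parcs J `` {v} \<subseteq> pverts J - {v}"
    using J nbsv V v by (auto simp: pair_graph_iff)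
  then have "parcs ?S \<subseteq> pverts ?S \<times> pverts ?S"
    unfolding arcs verts by blast
  moreover have "sym (parcs ?S)"
    using J.arcs_symmetric unfolding arcs by (auto intro!: symI)
  moreover have "irrefl (parcs ?S)"
    using nbsv HB unfolding arcs by (auto simp: irrefl_def)
  ultimately have S: "pair_graph ?S"
    by (simp add: pair_graph_iff)
  have part: "split_partition ?S (pverts H \<union> (A - {v})) B"
    unfolding split_partition_def
  proof (intro conjI)
    show "pverts H \<union> (A - {v}) \<union> B = pverts ?S" "(pverts H \<union> (A - {v})) \<inter> B = {}"
      using V v HB by (auto simp: verts)
    show "independent_set ?S (pverts H \<union> (A - {v}))"
      unfolding independent_set_def
    proof (intro conjI ballI)
      fix u w assume uw: "u \<in> pverts H \<union> (A - {v})" "w \<in> pverts H \<union> (A - {v})"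
      have "u \<notin> parcs J `` {v}" "w \<notin> parcs J `` {v}"
        using uw nbsv HB V(2) by blast+
      moreover have "x \<in> A" if "x \<in> pverts H \<union> (A - {v})" "x \<in> pverts J" for x
        using that disj[of x] v by blast
      then have "(u, w) \<notin> parcs J"
        using uw indep J.in_arcsD1 J.in_arcsD2 by metis
      ultimately show "(u, w) \<notin> parcs ?S"
        unfolding arcs by auto
    qed (use V in \<open>auto simp: verts\<close>)
    show "clique ?S B"
      unfolding clique_def verts arcs using V v clq by blast
  qed
  have old: "parcs ?S `` {w} = parcs J `` {w}" if "w \<in> A - {v}" "w \<notin> pverts H" for w
  proof -
    have "w \<notin> parcs J `` {v}" "(w, v) \<notin> parcs J" "w \<noteq> v"
      using that v indep by auto
    then show ?thesis
      using that unfolding arcs by auto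
  qed
  have new: "parcs ?S `` {w} = parcs J `` {v}" if "w \<in> pverts H" for w
  proof -
    have "w \<notin> parcs J `` {v}" "(w, y) \<notin> parcs J \<or> w = v" for y
      using disj[OF that] HB[OF that] nbsv J.in_arcsD1 by blast+
    then show ?thesis
      using that unfolding arcs by auto
  qed
  have "\<exists>u\<in>A. parcs ?S `` {w} = parcs J `` {u}" if "w \<in> pverts H \<union> (A - {v})" for w
    using that old new v by blast
  then have "(\<forall>w\<in>pverts H \<union> (A - {v}). \<exists>x. parcs ?S `` {w} = {x}) \<or>
    (\<forall>w\<in>pverts H \<union> (A - {v}). \<exists>x. parcs ?S `` {w} = B - {x})"
    using nbs by metis
  then show ?case
    using S part \<open>F \<subseteq> A\<close> by (intro exI[of _ "pverts H \<union> (A - {v})"] exI[of _ B]) auto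
qed

text \<open>In any split partition the vertices \<open>v\<close> and \<open>w\<close> of a kite lie
  in the independent set and \<open>x\<close>, \<open>y\<close>, \<open>z\<close> in the clique.
  Since \<open>w\<close> sees both \<open>x\<close> and \<open>y\<close>, neighbourhoods are not
  singletons; since \<open>v\<close> misses both, they are not all of \<open>B\<close> up to one
  vertex.\<close>

lemma bottom_expanded_spider_kite_free:
  assumes "bottom_expanded_spider G"
  shows "\<not> embeds kite G"
proof
  assume emb: "embeds kite G"
  obtain A B where G: "pair_graph G" and part: "split_partition G A B"
    and nbs: "(\<forall>v\<in>A. \<exists>x. parcs G `` {v} = {x}) \<or> (\<forall>v\<in>A. \<exists>x. parcs G `` {v} = B - {x})"
    using assms foot_expansion_nbs unfolding bottom_expanded_spider_def by blast
  interpret pair_graph G by fact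
  obtain v w x y z where e: "v \<sim> z" "z \<sim> y" "z \<sim> x" "y \<sim> x" "y \<sim> w" "x \<sim> w"
    and ne: "\<not> v \<sim> w" "\<not> v \<sim> x" "\<not> v \<sim> y" "\<not> z \<sim> w"
    using emb unfolding embeds_kite_iff by blast
  have V: "pverts G = A \<union> B"
    and indep: "\<And>u v. u \<in> A \<Longrightarrow> v \<in> A \<Longrightarrow> \<not> u \<sim> v"
    and clq: "\<And>u v. u \<in> B \<Longrightarrow> v \<in> B \<Longrightarrow> u \<noteq> v \<Longrightarrow> u \<sim> v"
    using part by (auto simp: split_partition_def independent_set_def clique_def)
  have mem: "v \<in> A \<union> B" "w \<in> A \<union> B" "x \<in> A \<union> B" "y \<in> A \<union> B" "z \<in> A \<union> B"
    using e in_arcsD1 in_arcsD2 V by auto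
  have dist: "v \<noteq> x" "v \<noteq> y" "z \<noteq> w" "x \<noteq> y"
    using e ne adj_sym by auto
  have "v \<in> A"
  proof (rule ccontr)
    assume "v \<notin> A"
    then have "x \<in> A" "y \<in> A"
      using mem clq ne dist by blast+
    then show False
      using indep e by blast
  qed
  then have "z \<in> B"
    using mem indep e by blast
  then have "w \<in> A"
    using mem clq ne dist by blast
  then have xy: "x \<in> B" "y \<in> B" "w \<sim> x" "w \<sim> y"
    using mem indep e adj_sym by blast+
  show False
    using nbs
  proof
    assume "\<forall>v\<in>A. \<exists>x. nbs v = {x}"
    then obtain p where "nbs w = {p}"
      using \<open>w \<in> A\<close> by blast
    then show False
      using xy dist by (auto simp: set_eq_iff)
  next
    assume "\<forall>v\<in>A. \<exists>x. nbs v = B - {x}"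
    then obtain p where "nbs v = B - {p}"
      using \<open>v \<in> A\<close> by blast
    then have "x = p" "y = p"
      using xy ne by blast+
    then show False
      using dist by simp
  qed
qed

text \<open>Each of the two edges has an end in the clique, and these two ends would be
  adjacent.\<close>

lemma split_graph_two_K2_free:
  assumes "split_graph G"
  shows "\<not> embeds two_K2 G"
proof
  assume emb: "embeds two_K2 G"
  obtain A B where G: "pair_graph G" and part: "split_partition G A B"
    using assms unfolding split_graph_def by blast
  interpret pair_graph G by fact
  obtain a b c d where e: "a \<sim> b" "c \<sim> d" "\<not> a \<sim> c" "\<not> a \<sim> d" "\<not> b \<sim> c" "\<not> b \<sim> d"
    using emb unfolding embeds_two_K2_iff by blast
  have "u \<in> B \<or> v \<in> B" if "u \<sim> v" for u v
    using part that in_arcsD1 in_arcsD2 unfolding split_partition_def independent_set_def by blast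
  then have "a \<in> B \<or> b \<in> B" "c \<in> B \<or> d \<in> B"
    using e by blast+
  moreover have "u = v" if "u \<in> B" "v \<in> B" "\<not> u \<sim> v" for u v
    using part that unfolding split_partition_def clique_def by blast
  ultimately show False
    using e adj_sym by metis
qed

text \<open>Each of the two diagonals has an end in the independent set, yet ends of different
  diagonals are adjacent.\<close>

lemma split_graph_C4_free:
  assumes "split_graph G"
  shows "\<not> embeds (cycle_graph 4) G"
proof
  assume emb: "embeds (cycle_graph 4) G"
  obtain A B where G: "pair_graph G" and part: "split_partition G A B"
    using assms unfolding split_graph_def by blast
  interpret pair_graph G by fact
  obtain a b c d where e: "a \<sim> b" "b \<sim> c" "c \<sim> d" "d \<sim> a" "\<not> a \<sim> c" "\<not> b \<sim> d" "a \<noteq> c" "b \<noteq> d"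
    using emb unfolding embeds_C4_iff by blast
  have "{a, b, c, d} \<subseteq> A \<union> B"
    using part e in_arcsD1 unfolding split_partition_def by blast
  moreover have "u = v" if "u \<in> B" "v \<in> B" "\<not> u \<sim> v" for u v
    using part that unfolding split_partition_def clique_def by blast
  ultimately have "a \<in> A \<or> c \<in> A" "b \<in> A \<or> d \<in> A"
    using e by blast+
  moreover have "\<not> u \<sim> v" if "u \<in> A" "v \<in> A" for u v
    using part that unfolding split_partition_def independent_set_def by blast
  ultimately show False
    using e adj_sym by metis
qed

lemma embeds_kite_card:
  assumes "pair_graph G" "embeds kite G"
  shows "card (pverts G) > 1"
proof -
  obtain f where "inj_on f (pverts kite)" "f ` pverts kite \<subseteq> pverts G"
    using assms(2) unfolding embeds_def by blast
  moreover have "finite (pverts G)"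
    using assms(1) by (simp add: pair_graph_iff)
  ultimately have "card (pverts kite) \<le> card (pverts G)"
    by (rule card_inj_on_le)
  then show ?thesis
    by (simp add: kite_eq undirected_def)
qed

section \<open>Reduction of the characterisation to the components\<close>

theorem corollary2p10:
  fixes G G0 :: "'a graph" and Ss :: "'a splitted list"
  assumes "pair_graph G"
    and "canonical_decomposition G Ss G0"
  shows "induced_free {two_K2, cycle_graph 4, kite} G \<longleftrightarrow>
    (split_graph G0 \<or> graph_iso G0 (cycle_graph 5)) \<and>
    (\<forall>H\<in>set (components Ss G0).
       split_graph H \<and> card (pverts H) > 1 \<longrightarrow> bottom_expanded_spider H)"
proof -
  let ?C = "set (components Ss G0)"
  have Ss: "\<forall>S\<in>set Ss. splitted_graph S" "pair_graph G0"
    "sorted_wrt disjnt (map pverts (components Ss G0))"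
    and indec: "\<And>H. H \<in> ?C \<Longrightarrow> \<not> decomposable H"
    and G: "G = foldr (\<odot>) Ss G0"
    using assms(2) unfolding canonical_decomposition_def by blast+
  note comp = components_induced[OF Ss, folded G]
  have sub: "pverts H \<subseteq> pverts G" "induced G (pverts H) = H" if "H \<in> ?C" for H
    using comp that by auto
  have pg: "pair_graph H" if "H \<in> ?C" for H
    using pair_graph_induced[OF assms(1) sub(1)[OF that]] sub(2)[OF that] by simp
  have emb: "embeds X G" if "embeds X H" "H \<in> ?C" for X :: "nat graph" and H
    using embeds_induced[of X G "pverts H"] sub[OF that(2)] that(1) by simp
  \<comment> \<open>Only the last component can fail to be split, as the others come with a split
    partition.\<close>
  have split: "split_graph H \<or> H = G0" if "H \<in> ?C" for H
    using that Ss(1) by (fastforce simp: components_def split_graph_def)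
  have G0: "G0 \<in> ?C"
    by (simp add: components_def)
  have "induced_free {two_K2, cycle_graph 4, kite} G \<longleftrightarrow>
      \<not> embeds two_K2 G \<and> \<not> embeds (cycle_graph 4) G \<and> \<not> embeds kite G"
    using pair_graph_two_K2 pair_graph_cycle_4 pair_graph_kite
    by (subst induced_free_iff[OF assms(1)]) auto
  also have "\<dots> \<longleftrightarrow> (split_graph G0 \<or> graph_iso G0 (cycle_graph 5)) \<and>
    (\<forall>H\<in>?C. split_graph H \<and> card (pverts H) > 1 \<longrightarrow> bottom_expanded_spider H)"
    (is "?free \<longleftrightarrow> ?struct")
  proof
    assume free: ?free
    have "split_graph G0 \<or> graph_iso G0 (cycle_graph 5)"
      using split_or_C5[OF Ss(2) indec[OF G0]] free emb G0 by blast
    moreover have "bottom_expanded_spider H"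
      if H: "H \<in> ?C" "split_graph H" "card (pverts H) > 1" for H
    proof -
      obtain A B where "split_partition H A B"
        using H(2) unfolding split_graph_def by blast
      moreover have "\<not> embeds kite H"
        using emb H(1) free by blast
      ultimately show ?thesis
        using pair_graph.bottom_expanded_spider_if_kite_free[OF pg[OF H(1)]] H(3) indec[OF H(1)]
        by blast
    qed
    ultimately show ?struct
      by blast
  next
    assume struct: ?struct
    \<comment> \<open>A component that is not split must be \<open>G0\<close>, hence a 5-cycle.
      Forbidden graphs in split components are excluded separately.\<close>
    have C5: "embeds X (cycle_graph 5)"
      if "H \<in> ?C" "embeds X H" "\<not> split_graph H" "pair_graph X" for X :: "nat graph" and H
    proof -
      have "H = G0"
        using split that by blast
      then show ?thesis
        using struct embeds_iso_C5[OF Ss(2)] that by blast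
    qed
    have component: "\<exists>H\<in>?C. embeds X H"
      if "embeds X G" "pair_graph X" "\<not> decomposable X" for X :: "nat graph"
      using embeds_foldr_compose[OF that(2,3) Ss] that(1) G by simp
    have "\<not> embeds two_K2 G"
      using component[OF _ pair_graph_two_K2 two_K2_indecomposable]
        split_graph_two_K2_free C5[OF _ _ _ pair_graph_two_K2] cycle_5_two_K2_free by blast
    moreover have "\<not> embeds (cycle_graph 4) G"
      using component[OF _ pair_graph_cycle_4 C4_indecomposable]
        split_graph_C4_free C5[OF _ _ _ pair_graph_cycle_4] cycle_5_C4_free by blast
    moreover have "\<not> embeds kite G"
    proof
      assume "embeds kite G"
      then obtain H where H: "H \<in> ?C" "embeds kite H"
        using component[OF _ pair_graph_kite kite_indecomposable] by blast
      then have "split_graph H"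
        using C5[OF _ _ _ pair_graph_kite] cycle_5_kite_free by blast
      moreover have "card (pverts H) > 1"
        using embeds_kite_card pg H by blast
      ultimately show False
        using struct H bottom_expanded_spider_kite_free by blast
    qed
    ultimately show ?free
      by blast
  qed
  finally show ?thesis .
qed

end
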